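(* Let $m\ge1$ and $q_1,\dots,q_m\in k^*$. The generalized Clifford algebra $C^{(n)}(q_1,\dots,q_m)$ has a unique weak Hopf algebra structure in the symmetric Gr-category $(\mathrm{Vec}_{\mathbb{Z}_n^m},\mathcal{R}_{F_{\rm GCA}})$, where $$F_{\rm GCA}(g,h)=\omega^{\sum_{1\le j<i\le m}g_ih_j}\prod_{i=1}^mq_i^{[\frac{g_i+h_i}{n}]},$$ with comultiplication $\Delta$, counit $\varepsilon$ and antipode $S$ given by $$\Delta(e_1^{g_1}\cdots e_m^{g_m})=\frac1{n^m}\sum_{h\in\mathbb{Z}_n^m}\omega^{-\sum_{1\le j<i\le m}h_i(g_j-h_j)'}\prod_{i=1}^m\mathbf{q}_i\; e_1^{h_1}\cdots e_m^{h_m}\otimes e_1^{(g_1-h_1)'}\cdots e_m^{(g_m-h_m)'},$$ $$\varepsilon(e_1^{g_1}\cdots e_m^{g_m})=n^m\delta_{g,0},\qquad S(e_1^{g_1}\cdots e_m^{g_m})=e_1^{g_1}\cdots e_m^{g_m},$$ for all $g=(g_1,\dots,g_m)\in\mathbb{Z}_n^m$, where for $h=(h_1,\dots,h_m)\in\mathbb{Z}_n^m$ $$\mathbf{q}_i=\begin{cases}q_i^{-1},& h_i>g_i,\\ 1,&\text{otherwise.}\end{cases}$$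
   Context: Standing assumptions: $n\ge 2$ is an integer, $k$ is a field with $\operatorname{char}k\nmid n$, and $\omega\in k$ is a primitive $n$-th root of unity; $k^*=k\setminus\{0\}$. Notation: $\mathbb{Z}_n^m$ is the direct product of $m$ copies of the cyclic group $\mathbb{Z}_n$, written additively; elements are $g=(g_1,\dots,g_m)$, each $g_i$ identified with its representative in $\{0,\dots,n-1\}$. $[a]$ is the integer part of a rational number $a$; $x'\in\{0,\dots,n-1\}$ is the residue of the integer $x$ modulo $n$; $\delta_{g,0}$ is the Kronecker delta. Generalized Clifford algebra: $C^{(n)}(q_1,\dots,q_m)$ (also written $C^n(q_1,\dots,q_m)$) is the associative unital $k$-algebra generated by $e_1,\dots,e_m$ subject to $e_i^n=q_i1$ for all $i$ and $e_ie_j=\omega e_je_i$ for all $i>j$. It has $k$-basis $\{e_1^{g_1}\cdots e_m^{g_m}: g\in\mathbb{Z}_n^m\}$ and is $\mathbb{Z}_n^m$-graded with $e_1^{g_1}\cdots e_m^{g_m}$ of degree $g$. Category: $\mathrm{Vec}_{\mathbb{Z}_n^m}$ is the category of finite-dimensional $\mathbb{Z}_n^m$-graded $k$-spaces with degree-preserving linear maps ($k$ sits in degree $0$), usual graded tensor product and trivial associativity constraint. $\mathcal{R}:=\mathcal{R}_{F_{\rm GCA}}$ is the symmetric braiding given by $$\mathcal{R}(g,h)=\frac{F_{\rm GCA}(g,h)}{F_{\rm GCA}(h,g)}=\omega^{\sum_{1\le j<i\le m}(g_ih_j-g_jh_i)},$$ acting as $u\otimes v\mapsto\mathcal{R}(|u|,|v|)\,v\otimes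 u$ on homogeneous elements ($|u|$ is the degree). An algebra in the category is a finite-dimensional associative unital algebra with $H_gH_h\subseteq H_{g+h}$; a coalgebra is a coassociative counital coalgebra whose comultiplication and counit are degree-preserving. Weak Hopf algebra in $(\mathrm{Vec}_{\mathbb{Z}_n^m},\mathcal{R})$: a tuple $(H,\text{mult},1,\Delta,\varepsilon,S)$ such that (Sweedler notation $\Delta(a)=a_1\otimes a_2$, with components taken homogeneous, and $\Delta(1)=1_1\otimes1_2=1_{(1)}\otimes1_{(2)}$): (1) $H$ is an algebra and (2) $(H,\Delta,\varepsilon)$ is a coalgebra in the category; (3) $\Delta(xy)=\Delta(x)\Delta(y)$ in $H\widehat\otimes H$, where $(a\otimes a')(b\otimes b')=\mathcal{R}(|a'|,|b|)\,ab\otimes a'b'$ for homogeneous elements; (4) for homogeneous $f,g,h\in H$: $\varepsilon((fg)h)=\varepsilon(fg_1)\varepsilon(g_2h)=\mathcal{R}(|g_1|,|g_2|)\,\varepsilon(fg_2)\varepsilon(g_1h)$, and $(1_{11}\otimes1_{12})\otimes1_2=(1_1\otimes1_21_{(1)})\otimes1_{(2)}=\mathcal{R}(|1_2|,|1_{(1)}|)\,(1_1\otimes1_{(1)}1_2)\otimes1_{(2)}$; (5) $S:H\to H$ is a degree-preserving linear map with, for homogeneous $h$: $h_1S(h_2)=\mathcal{R}(|1_2|,|h|)\,\varepsilon(1_1h)1_2$, $\;S(h_1)h_2=\mathcal{R}(|h|,|1_1|)\,1_1\varepsilon(h1_2)$, $\;S(h)=(S(h_1)h_2)S(h_3)$.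 "Unique weak Hopf algebra structure" means: the algebra structure and grading being the given ones, there is exactly one triple $(\Delta,\varepsilon,S)$ making it a weak Hopf algebra in the category. *)

theory Defs
  imports Complex_Main "HOL-Library.FuncSet" "HOL-Library.Poly_Mapping"
begin

section \<open>Formal linear combinations\<close>

text \<open>The free \<open>'k\<close>-vector space on \<open>'x\<close> is the type \<open>'x \<Rightarrow>\<^sub>0 'k\<close>.\<close>

definition fscale :: "'k::field \<Rightarrow> ('x \<Rightarrow>\<^sub>0 'k) \<Rightarrow> ('x \<Rightarrow>\<^sub>0 'k)" where
  "fscale c = Poly_Mapping.map (\<lambda>x. c * x)"

definition lin_ext :: "('k::field \<Rightarrow> 'v \<Rightarrow> 'v::comm_monoid_add) \<Rightarrow> ('x \<Rightarrow> 'v) \<Rightarrow> ('x \<Rightarrow>\<^sub>0 'k) \<Rightarrow> 'v" where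
  "lin_ext scale f p = (\<Sum>x\<in>Poly_Mapping.keys p. scale (Poly_Mapping.lookup p x) (f x))"


section \<open>Algebras presented by generators and relations\<close>

text \<open>The free monoid on \<open>'x\<close>, written additively so that the convolution product of
  \<open>'x word \<Rightarrow>\<^sub>0 'k\<close> makes it the free associative unital algebra on \<open>'x\<close>.\<close>

datatype 'x word = Word (letters: "'x list")

instantiation word :: (type) monoid_add
begin
definition zero_word :: "'a word" where "zero_word = Word []"
definition plus_word :: "'a word \<Rightarrow> 'a word \<Rightarrow> 'a word" where
  "plus_word u v = Word (letters u @ letters v)"
instance by standard (simp_all add: zero_word_def plus_word_def)
end

definition free_algebra :: "'x set \<Rightarrow> ('x word \<Rightarrow>\<^sub>0 'k::field) set" where
  "free_algebra X = {p. \<forall>w\<in>Poly_Mapping.keys p. set (letters w) \<subseteq> X}"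

definition relation_ideal :: "'x set \<Rightarrow> ('x word \<Rightarrow>\<^sub>0 'k::field) set \<Rightarrow> ('x word \<Rightarrow>\<^sub>0 'k) set" where
  "relation_ideal X R =
     module.span fscale {u * r * v | u r v. u \<in> free_algebra X \<and> r \<in> R \<and> v \<in> free_algebra X}"

definition eval_word :: "('x \<Rightarrow> 'a::monoid_mult) \<Rightarrow> 'x word \<Rightarrow> 'a" where
  "eval_word e w = prod_list (map e (letters w))"

definition k_algebra :: "('k::field \<Rightarrow> 'a::ring_1 \<Rightarrow> 'a) \<Rightarrow> bool" where
  "k_algebra scale \<longleftrightarrow> vector_space scale \<and>
     (\<forall>c x y. scale c (x * y) = scale c x * y \<and> scale c (x * y) = x * scale c y)"

text \<open>The algebra \<open>'a\<close> is generated by the \<open>e x\<close>, \<open>x \<in> X\<close>, subject to the relations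
  \<open>r = 0\<close>, \<open>r \<in> R\<close>: evaluation at \<open>e\<close> identifies it with the quotient of the free algebra
  by the two-sided ideal generated by \<open>R\<close>.\<close>

definition presented_by ::
  "('k::field \<Rightarrow> 'a::ring_1 \<Rightarrow> 'a) \<Rightarrow> ('x \<Rightarrow> 'a) \<Rightarrow> 'x set \<Rightarrow> ('x word \<Rightarrow>\<^sub>0 'k) set \<Rightarrow> bool" where
  "presented_by scale e X R \<longleftrightarrow>
     k_algebra scale \<and>
     lin_ext scale (eval_word e) ` free_algebra X = UNIV \<and>
     {p \<in> free_algebra X. lin_ext scale (eval_word e) p = 0} = relation_ideal X R"


section \<open>The group of degrees\<close>

text \<open>Elements of \<open>\<int>\<^sub>n\<^sup>m\<close> are the tuples \<open>(g\<^sub>1, \<dots>, g\<^sub>m)\<close> of representatives in \<open>{0, \<dots>, n - 1}\<close>,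
  encoded as functions that are \<^const>\<open>undefined\<close> outside \<open>{1..m}\<close>.\<close>

definition Znm :: "nat \<Rightarrow> nat \<Rightarrow> (nat \<Rightarrow> nat) set" where
  "Znm n m = (\<Pi>\<^sub>E i\<in>{1..m}. {0..<n})"

definition zero_Znm :: "nat \<Rightarrow> nat \<Rightarrow> nat" where
  "zero_Znm m = (\<lambda>i\<in>{1..m}. 0)"

definition add_Znm :: "nat \<Rightarrow> nat \<Rightarrow> (nat \<Rightarrow> nat) \<Rightarrow> (nat \<Rightarrow> nat) \<Rightarrow> nat \<Rightarrow> nat" where
  "add_Znm n m g h = (\<lambda>i\<in>{1..m}. (g i + h i) mod n)"

definition diff_Znm :: "nat \<Rightarrow> nat \<Rightarrow> (nat \<Rightarrow> nat) \<Rightarrow> (nat \<Rightarrow> nat) \<Rightarrow> nat \<Rightarrow> nat" where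
  "diff_Znm n m g h = (\<lambda>i\<in>{1..m}. nat ((int (g i) - int (h i)) mod int n))"


section \<open>Generalized Clifford algebras\<close>

definition primitive_root_of_unity :: "nat \<Rightarrow> 'k::field \<Rightarrow> bool" where
  "primitive_root_of_unity n \<omega> \<longleftrightarrow> n > 0 \<and> \<omega> ^ n = 1 \<and> (\<forall>d. 0 < d \<and> d < n \<longrightarrow> \<omega> ^ d \<noteq> 1)"

definition gca_relations :: "nat \<Rightarrow> nat \<Rightarrow> 'k::field \<Rightarrow> (nat \<Rightarrow> 'k) \<Rightarrow> (nat word \<Rightarrow>\<^sub>0 'k) set" where
  "gca_relations n m \<omega> q =
     {Poly_Mapping.single (Word (replicate n i)) 1 - Poly_Mapping.single (Word []) (q i) | i.
        i \<in> {1..m}} \<union>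
     {Poly_Mapping.single (Word [i, j]) 1 - Poly_Mapping.single (Word [j, i]) \<omega> | i j.
        i \<in> {1..m} \<and> j \<in> {1..m} \<and> i > j}"

definition generalized_clifford_algebra ::
  "nat \<Rightarrow> nat \<Rightarrow> 'k::field \<Rightarrow> (nat \<Rightarrow> 'k) \<Rightarrow> ('k \<Rightarrow> 'a::ring_1 \<Rightarrow> 'a) \<Rightarrow> (nat \<Rightarrow> 'a) \<Rightarrow> bool" where
  "generalized_clifford_algebra n m \<omega> q scale e \<longleftrightarrow>
     presented_by scale e {1..m} (gca_relations n m \<omega> q)"

definition monomial :: "nat \<Rightarrow> (nat \<Rightarrow> 'a::monoid_mult) \<Rightarrow> (nat \<Rightarrow> nat) \<Rightarrow> 'a" where
  "monomial m e g = prod_list (map (\<lambda>i. e i ^ g i) [1..<Suc m])"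

definition gca_grading ::
  "nat \<Rightarrow> ('k \<Rightarrow> 'a \<Rightarrow> 'a) \<Rightarrow> (nat \<Rightarrow> 'a::monoid_mult) \<Rightarrow> (nat \<Rightarrow> nat) \<Rightarrow> 'a set" where
  "gca_grading m scale e g = {scale c (monomial m e g) | c. True}"

definition F_GCA ::
  "nat \<Rightarrow> nat \<Rightarrow> 'k::field \<Rightarrow> (nat \<Rightarrow> 'k) \<Rightarrow> (nat \<Rightarrow> nat) \<Rightarrow> (nat \<Rightarrow> nat) \<Rightarrow> 'k" where
  "F_GCA n m \<omega> q g h =
     \<omega> ^ (\<Sum>i\<in>{1..m}. \<Sum>j\<in>{1..<i}. g i * h j) * (\<Prod>i\<in>{1..m}. q i ^ ((g i + h i) div n))"

definition braiding_of ::
  "((nat \<Rightarrow> nat) \<Rightarrow> (nat \<Rightarrow> nat) \<Rightarrow> 'k::field) \<Rightarrow> (nat \<Rightarrow> nat) \<Rightarrow> (nat \<Rightarrow> nat) \<Rightarrow> 'k" where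
  "braiding_of F g h = F g h / F h g"


section \<open>Tensor powers\<close>

text \<open>\<open>V \<otimes> V\<close> and \<open>V \<otimes> V \<otimes> V\<close> are the quotients of the free vector spaces on pairs and on
  triples by the span of the multilinearity relations.  The set \<open>\<Sigma>\<close> below consists of the
  maps that put a vector into one slot of a tuple, the other entries being fixed.\<close>

definition multilinear_relations ::
  "('k::field \<Rightarrow> 'a::ab_group_add \<Rightarrow> 'a) \<Rightarrow> ('a \<Rightarrow> 'x) set \<Rightarrow> ('x \<Rightarrow>\<^sub>0 'k) set" where
  "multilinear_relations scale \<Sigma> = module.span fscale
     ({Poly_Mapping.single (\<sigma> (u + v)) 1 - Poly_Mapping.single (\<sigma> u) 1 - Poly_Mapping.single (\<sigma> v) 1
         | \<sigma> u v. \<sigma> \<in> \<Sigma>} \<union>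
      {Poly_Mapping.single (\<sigma> (scale c u)) 1 - Poly_Mapping.single (\<sigma> u) c | \<sigma> c u. \<sigma> \<in> \<Sigma>})"

definition tensor2_rel ::
  "('k::field \<Rightarrow> 'a::ab_group_add \<Rightarrow> 'a) \<Rightarrow> (('a \<times> 'a \<Rightarrow>\<^sub>0 'k) \<times> ('a \<times> 'a \<Rightarrow>\<^sub>0 'k)) set" where
  "tensor2_rel scale = {(s, t). s - t \<in> multilinear_relations scale
     ({\<lambda>u. (u, b) | b. True} \<union> {\<lambda>u. (a, u) | a. True})}"

definition tensor3_rel ::
  "('k::field \<Rightarrow> 'a::ab_group_add \<Rightarrow> 'a) \<Rightarrow> (('a \<times> 'a \<times> 'a \<Rightarrow>\<^sub>0 'k) \<times> ('a \<times> 'a \<times> 'a \<Rightarrow>\<^sub>0 'k)) set" where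
  "tensor3_rel scale = {(s, t). s - t \<in> multilinear_relations scale
     ({\<lambda>u. (u, b, c) | b c. True} \<union> {\<lambda>u. (a, u, c) | a c. True} \<union> {\<lambda>u. (a, b, u) | a b. True})}"

type_synonym ('k, 'a) tensor2 = "('a \<times> 'a \<Rightarrow>\<^sub>0 'k) set"
type_synonym ('k, 'a) tensor3 = "('a \<times> 'a \<times> 'a \<Rightarrow>\<^sub>0 'k) set"

definition tensor2_space :: "('k::field \<Rightarrow> 'a::ab_group_add \<Rightarrow> 'a) \<Rightarrow> ('k, 'a) tensor2 set" where
  "tensor2_space scale = UNIV // tensor2_rel scale"

definition tensor2 ::
  "('k::field \<Rightarrow> 'a::ab_group_add \<Rightarrow> 'a) \<Rightarrow> ('a \<times> 'a \<Rightarrow>\<^sub>0 'k) \<Rightarrow> ('k, 'a) tensor2" where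
  "tensor2 scale s = tensor2_rel scale `` {s}"

definition tensor3 ::
  "('k::field \<Rightarrow> 'a::ab_group_add \<Rightarrow> 'a) \<Rightarrow> ('a \<times> 'a \<times> 'a \<Rightarrow>\<^sub>0 'k) \<Rightarrow> ('k, 'a) tensor3" where
  "tensor3 scale s = tensor3_rel scale `` {s}"

text \<open>Sweedler notation: for \<open>t = \<Sum> a \<otimes> b\<close> in \<open>V \<otimes> V\<close>, this is \<open>\<Sum> f a b\<close>.  It is independent of
  the representative of \<open>t\<close> whenever \<open>f\<close> is bilinear.  When \<open>f\<close> takes values in formal
  combinations of tuples and is bilinear only modulo the multilinearity relations, the
  result is well defined as an element of the corresponding tensor power, so it is always
  put under \<^const>\<open>tensor2\<close> or \<^const>\<open>tensor3\<close> in that case.\<close>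

definition sweedler ::
  "('k::field \<Rightarrow> 'v \<Rightarrow> 'v::comm_monoid_add) \<Rightarrow> ('k, 'a) tensor2 \<Rightarrow> ('a \<Rightarrow> 'a \<Rightarrow> 'v) \<Rightarrow> 'v" where
  "sweedler scale t f = lin_ext scale (\<lambda>(a, b). f a b) (SOME s. s \<in> t)"


section \<open>Algebras and coalgebras graded by the group of degrees\<close>

definition graded_space ::
  "nat \<Rightarrow> nat \<Rightarrow> ('k::field \<Rightarrow> 'a::ab_group_add \<Rightarrow> 'a) \<Rightarrow> ((nat \<Rightarrow> nat) \<Rightarrow> 'a set) \<Rightarrow> bool" where
  "graded_space n m scale H \<longleftrightarrow>
     vector_space scale \<and>
     (\<exists>B. finite B \<and> module.span scale B = UNIV) \<and>
     (\<forall>g\<in>Znm n m. module.subspace scale (H g)) \<and>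
     (\<forall>a. \<exists>!x. x \<in> (\<Pi>\<^sub>E g\<in>Znm n m. H g) \<and> a = (\<Sum>g\<in>Znm n m. x g))"

text \<open>The projection onto the homogeneous component of degree \<open>g\<close>.  Expressions of the form
  \<open>\<R>(|a|, |b|) \<phi>(a, b)\<close> for homogeneous \<open>a, b\<close> are extended to arbitrary \<open>a, b\<close> by summing over
  all pairs of homogeneous components; this realises the convention that the components in
  Sweedler notation are taken homogeneous.\<close>

definition component ::
  "nat \<Rightarrow> nat \<Rightarrow> ((nat \<Rightarrow> nat) \<Rightarrow> 'a::ab_group_add set) \<Rightarrow> (nat \<Rightarrow> nat) \<Rightarrow> 'a \<Rightarrow> 'a" where
  "component n m H g a = (THE x. x \<in> (\<Pi>\<^sub>E g\<in>Znm n m. H g) \<and> a = (\<Sum>g\<in>Znm n m. x g)) g"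

definition graded_algebra ::
  "nat \<Rightarrow> nat \<Rightarrow> ('k::field \<Rightarrow> 'a::ring_1 \<Rightarrow> 'a) \<Rightarrow> ((nat \<Rightarrow> nat) \<Rightarrow> 'a set) \<Rightarrow> bool" where
  "graded_algebra n m scale H \<longleftrightarrow>
     graded_space n m scale H \<and> k_algebra scale \<and>
     (\<forall>g\<in>Znm n m. \<forall>h\<in>Znm n m. \<forall>x\<in>H g. \<forall>y\<in>H h. x * y \<in> H (add_Znm n m g h))"

text \<open>Linearity of \<open>\<Delta>\<close> is expressed on representatives.  \<open>\<Delta>\<close> preserves degrees in the sense that
  \<open>\<Delta>(H\<^sub>g)\<close> lies in the sum of the \<open>H\<^sub>u \<otimes> H\<^sub>v\<close> with \<open>u + v = g\<close>; \<open>\<epsilon>\<close> does because the ground field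
  sits in degree \<open>0\<close>.\<close>

definition graded_coalgebra ::
  "nat \<Rightarrow> nat \<Rightarrow> ('k::field \<Rightarrow> 'a::ab_group_add \<Rightarrow> 'a) \<Rightarrow> ((nat \<Rightarrow> nat) \<Rightarrow> 'a set) \<Rightarrow>
     ('a \<Rightarrow> ('k, 'a) tensor2) \<Rightarrow> ('a \<Rightarrow> 'k) \<Rightarrow> bool" where
  "graded_coalgebra n m scale H \<Delta> \<epsilon> \<longleftrightarrow>
     graded_space n m scale H \<and>
     (\<forall>x. \<Delta> x \<in> tensor2_space scale) \<and>
     (\<forall>x y. \<forall>s\<in>\<Delta> x. \<forall>t\<in>\<Delta> y. s + t \<in> \<Delta> (x + y)) \<and>
     (\<forall>c x. \<forall>s\<in>\<Delta> x. fscale c s \<in> \<Delta> (scale c x)) \<and>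
     Vector_Spaces.linear scale (*) \<epsilon> \<and>
     (\<forall>g\<in>Znm n m. \<forall>x\<in>H g. \<exists>s\<in>\<Delta> x. Poly_Mapping.keys s \<subseteq>
        (\<Union>(u, v)\<in>{(u, v). u \<in> Znm n m \<and> v \<in> Znm n m \<and> add_Znm n m u v = g}. H u \<times> H v)) \<and>
     (\<forall>g\<in>Znm n m. g \<noteq> zero_Znm m \<longrightarrow> (\<forall>x\<in>H g. \<epsilon> x = 0)) \<and>
     (\<forall>x. tensor3 scale (sweedler fscale (\<Delta> x) (\<lambda>a b. sweedler fscale (\<Delta> a) (\<lambda>a1 a2.
              Poly_Mapping.single (a1, a2, b) 1))) =
          tensor3 scale (sweedler fscale (\<Delta> x) (\<lambda>a b. sweedler fscale (\<Delta> b) (\<lambda>b1 b2.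
              Poly_Mapping.single (a, b1, b2) 1)))) \<and>
     (\<forall>x. sweedler scale (\<Delta> x) (\<lambda>a b. scale (\<epsilon> a) b) = x \<and>
          sweedler scale (\<Delta> x) (\<lambda>a b. scale (\<epsilon> b) a) = x)"


section \<open>Weak Hopf algebras\<close>

text \<open>The product of the braided tensor product \<open>H \<otimes> H\<close>:
  \<open>(a \<otimes> a')(b \<otimes> b') = \<R>(|a'|, |b|) ab \<otimes> a'b'\<close> for homogeneous elements.\<close>

definition braided_mult ::
  "nat \<Rightarrow> nat \<Rightarrow> ((nat \<Rightarrow> nat) \<Rightarrow> (nat \<Rightarrow> nat) \<Rightarrow> 'k::field) \<Rightarrow> ('k \<Rightarrow> 'a::ring_1 \<Rightarrow> 'a) \<Rightarrow>
     ((nat \<Rightarrow> nat) \<Rightarrow> 'a set) \<Rightarrow> ('k, 'a) tensor2 \<Rightarrow> ('k, 'a) tensor2 \<Rightarrow> ('k, 'a) tensor2" where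
  "braided_mult n m \<R> scale H s t = tensor2 scale
     (sweedler fscale s (\<lambda>a a'. sweedler fscale t (\<lambda>b b'.
        \<Sum>u\<in>Znm n m. \<Sum>v\<in>Znm n m.
          Poly_Mapping.single (a * component n m H v b, component n m H u a' * b') (\<R> u v))))"

definition weak_hopf_algebra ::
  "nat \<Rightarrow> nat \<Rightarrow> ((nat \<Rightarrow> nat) \<Rightarrow> (nat \<Rightarrow> nat) \<Rightarrow> 'k::field) \<Rightarrow> ('k \<Rightarrow> 'a::ring_1 \<Rightarrow> 'a) \<Rightarrow>
     ((nat \<Rightarrow> nat) \<Rightarrow> 'a set) \<Rightarrow> ('a \<Rightarrow> ('k, 'a) tensor2) \<Rightarrow> ('a \<Rightarrow> 'k) \<Rightarrow> ('a \<Rightarrow> 'a) \<Rightarrow> bool" where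
  "weak_hopf_algebra n m \<R> scale H \<Delta> \<epsilon> S \<longleftrightarrow>
     graded_algebra n m scale H \<and>
     graded_coalgebra n m scale H \<Delta> \<epsilon> \<and>
     (\<forall>x y. \<Delta> (x * y) = braided_mult n m \<R> scale H (\<Delta> x) (\<Delta> y)) \<and>
     (\<forall>df\<in>Znm n m. \<forall>dg\<in>Znm n m. \<forall>dh\<in>Znm n m. \<forall>f\<in>H df. \<forall>g\<in>H dg. \<forall>h\<in>H dh.
        \<epsilon> (f * g * h) = sweedler (*) (\<Delta> g) (\<lambda>g1 g2. \<epsilon> (f * g1) * \<epsilon> (g2 * h)) \<and>
        \<epsilon> (f * g * h) = sweedler (*) (\<Delta> g) (\<lambda>g1 g2. \<Sum>u\<in>Znm n m. \<Sum>v\<in>Znm n m.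
          \<R> u v * (\<epsilon> (f * component n m H v g2) * \<epsilon> (component n m H u g1 * h)))) \<and>
     tensor3 scale (sweedler fscale (\<Delta> 1) (\<lambda>a b. sweedler fscale (\<Delta> a) (\<lambda>a1 a2.
        Poly_Mapping.single (a1, a2, b) 1))) =
     tensor3 scale (sweedler fscale (\<Delta> 1) (\<lambda>a b. sweedler fscale (\<Delta> 1) (\<lambda>a' b'.
        Poly_Mapping.single (a, b * a', b') 1))) \<and>
     tensor3 scale (sweedler fscale (\<Delta> 1) (\<lambda>a b. sweedler fscale (\<Delta> a) (\<lambda>a1 a2.
        Poly_Mapping.single (a1, a2, b) 1))) =
     tensor3 scale (sweedler fscale (\<Delta> 1) (\<lambda>a b. sweedler fscale (\<Delta> 1) (\<lambda>a' b'.
        \<Sum>u\<in>Znm n m. \<Sum>v\<in>Znm n m.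
          Poly_Mapping.single (a, component n m H v a' * component n m H u b, b') (\<R> u v)))) \<and>
     Vector_Spaces.linear scale scale S \<and>
     (\<forall>g\<in>Znm n m. \<forall>h\<in>H g. S h \<in> H g) \<and>
     (\<forall>g\<in>Znm n m. \<forall>h\<in>H g.
        sweedler scale (\<Delta> h) (\<lambda>h1 h2. h1 * S h2) =
          sweedler scale (\<Delta> 1) (\<lambda>a b. \<Sum>u\<in>Znm n m.
            scale (\<R> u g * \<epsilon> (a * h)) (component n m H u b)) \<and>
        sweedler scale (\<Delta> h) (\<lambda>h1 h2. S h1 * h2) =
          sweedler scale (\<Delta> 1) (\<lambda>a b. \<Sum>u\<in>Znm n m.
            scale (\<R> g u * \<epsilon> (h * b)) (component n m H u a)) \<and>
        S h = sweedler scale (\<Delta> h) (\<lambda>a h3. sweedler scale (\<Delta> a) (\<lambda>h1 h2. (S h1 * h2) * S h3)))"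

end

theory Submission
  imports Defs
begin

text \<open>
  The monomials \<open>x g = e\<^sub>1\<^bsup>g\<^sub>1\<^esup> \<cdots> e\<^sub>m\<^bsup>g\<^sub>m\<^esup>\<close> form a basis with \<open>x g * x h = F(g, h) x (g + h)\<close>: they
  span by the commutation rules, and they are independent because sending a word with letter
  counts \<open>c\<^sub>i\<close> to \<open>\<omega>\<^bsup>inversions\<^esup> \<Prod> q\<^sub>i\<^bsup>[c\<^sub>i / n]\<^esup>\<close>, placed in degree \<open>c mod n\<close>, kills the relation ideal.
  So the algebra is a twisted group algebra, and associativity makes \<open>F\<close> a normalised cocycle.

  Let \<open>\<lambda> = \<epsilon>(1)\<close>, the only value of \<open>\<epsilon>\<close> on a monomial that may be nonzero; the counit law forces
  \<open>\<lambda> \<noteq> 0\<close>. Weak multiplicativity of \<open>\<epsilon>\<close> determines \<open>\<Delta>(x g) = \<lambda>\<^sup>-\<^sup>1 \<Sum>\<^sub>h F(h, g - h)\<^sup>-\<^sup>1 x h \<otimes> x (g - h)\<close>,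
  and for this \<open>\<Delta>\<close> the cocycle identity gives \<open>\<Delta>(x) \<Delta>(y) = n\<^sup>m \<lambda>\<^sup>-\<^sup>1 \<Delta>(x y)\<close>, hence \<open>\<lambda> = n\<^sup>m\<close>. If
  \<open>S(x g) = s\<^sub>g x g\<close>, the first antipode axiom says \<open>\<Sum> s\<^sub>g = \<lambda>\<close>, and then the last one reads \<open>S(h) = h\<close>.
\<close>

section \<open>Formal linear combinations\<close>

lemma lookup_fscale [simp]: "Poly_Mapping.lookup (fscale c p) x = c * Poly_Mapping.lookup p x"
  by (simp add: fscale_def Poly_Mapping.map.rep_eq when_def)

lemma vector_space_fscale: "vector_space fscale"
  by unfold_locales (auto intro!: poly_mapping_eqI simp: lookup_add algebra_simps)

interpretation fscale: vector_space fscale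
  by (rule vector_space_fscale)

lemma fscale_single [simp]: "fscale c (Poly_Mapping.single x d) = Poly_Mapping.single x (c * d)"
  by (auto intro!: poly_mapping_eqI simp: lookup_single when_def)

lemma keys_fscale_subset: "Poly_Mapping.keys (fscale c p) \<subseteq> Poly_Mapping.keys p"
  by (auto simp: in_keys_iff)

lemma poly_mapping_eq_sum_single:
  "p = (\<Sum>x\<in>Poly_Mapping.keys p. Poly_Mapping.single x (Poly_Mapping.lookup p x))"
  by (rule poly_mapping_eqI)
     (simp add: lookup_sum lookup_single when_def in_keys_iff)

lemma vector_space_mult: "vector_space ((*) :: 'k::field \<Rightarrow> 'k \<Rightarrow> 'k)"
  by unfold_locales (auto simp: algebra_simps)

lemma linearI:
  assumes "vector_space s1" "vector_space s2"
    and "\<And>x y. f (x + y) = f x + f y" and "\<And>c x. f (s1 c x) = s2 c (f x)"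
  shows "Vector_Spaces.linear s1 s2 f"
  using assms by (simp add: Vector_Spaces.linear_iff)

lemma linearD:
  assumes "Vector_Spaces.linear s1 s2 f"
  shows linear_vs2: "vector_space s2"
    and linear_addD: "f (x + y) = f x + f y" and linear_scaleD: "f (s1 c x) = s2 c (f x)"
  using assms by (simp_all add: Vector_Spaces.linear_iff)

lemma linear_0D: "Vector_Spaces.linear s1 s2 f \<Longrightarrow> f 0 = 0"
  by (metis add_cancel_right_right linear_addD)

lemma linear_sumD: "Vector_Spaces.linear s1 s2 f \<Longrightarrow> f (sum g A) = (\<Sum>x\<in>A. f (g x))"
  by (induction A rule: infinite_finite_induct) (auto simp: linear_0D linear_addD)

context vector_space
begin

text \<open>Keys outside the support contribute zero, so combinations with different supports can be
  summed over one common finite set.\<close>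

lemma lin_ext_superset:
  assumes "finite A" "Poly_Mapping.keys p \<subseteq> A"
  shows "lin_ext scale f p = (\<Sum>x\<in>A. Poly_Mapping.lookup p x *s f x)"
  unfolding lin_ext_def using assms
  by (intro sum.mono_neutral_left) (auto simp: in_keys_iff)

lemma linear_lin_ext:
  fixes f :: "'x \<Rightarrow> 'b"
  shows "Vector_Spaces.linear fscale scale (lin_ext scale f)"
proof (rule linearI)
  fix p q :: "'x \<Rightarrow>\<^sub>0 'a" and c
  let ?A = "Poly_Mapping.keys p \<union> Poly_Mapping.keys q"
  have "lin_ext scale f (p + q) = (\<Sum>x\<in>?A. Poly_Mapping.lookup (p + q) x *s f x)"
    by (rule lin_ext_superset) (auto dest: Poly_Mapping.keys_add[THEN subsetD])
  also have "\<dots> = lin_ext scale f p + lin_ext scale f q"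
    by (simp add: lin_ext_superset[of ?A] lookup_add scale_left_distrib sum.distrib)
  finally show "lin_ext scale f (p + q) = lin_ext scale f p + lin_ext scale f q" .
  show "lin_ext scale f (fscale c p) = scale c (lin_ext scale f p)"
    by (subst lin_ext_superset[OF finite_keys keys_fscale_subset])
       (simp add: lin_ext_def scale_sum_right)
qed (use vector_space_fscale vector_space_axioms in auto)

lemmas lin_ext_add = linear_addD[OF linear_lin_ext]
  and lin_ext_fscale = linear_scaleD[OF linear_lin_ext]
  and lin_ext_sum = linear_sumD[OF linear_lin_ext]

lemma lin_ext_zero: "lin_ext scale f 0 = 0"
  by (simp add: lin_ext_def)

lemma lin_ext_diff: "lin_ext scale f (p - q) = lin_ext scale f p - lin_ext scale f q"
  by (metis add_diff_cancel_right' diff_add_cancel lin_ext_add)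

lemma lin_ext_single [simp]: "lin_ext scale f (Poly_Mapping.single x c) = c *s f x"
  by (subst lin_ext_superset[of "{x}"]) auto

end

lemma linear_comp_lin_ext:
  assumes "Vector_Spaces.linear s1 s2 \<phi>"
  shows "\<phi> (lin_ext s1 f p) = lin_ext s2 (\<lambda>x. \<phi> (f x)) p"
  by (simp add: lin_ext_def linear_sumD[OF assms] linear_scaleD[OF assms])

text \<open>A basis of \<open>M\<close> stays independent after adjoining \<open>v\<close>, so the
  values \<open>1\<close> at \<open>v\<close> and \<open>0\<close> on the basis extend linearly.
  Functionals can thus detect whether a vector lies in a span of relations.\<close>

lemma (in vector_space) exists_functional:
  assumes "subspace M" "v \<notin> M"
  obtains \<phi> where "Vector_Spaces.linear scale (*) \<phi>" "\<forall>x\<in>M. \<phi> x = 0" "\<phi> v = 1"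
proof -
  obtain B where B: "B \<subseteq> M" "independent B" "M \<subseteq> span B"
    using maximal_independent_subset by blast
  have sB: "span B = M"
    by (simp add: B assms(1) span_minimal subset_antisym)
  have ind: "independent (insert v B)"
    using B assms(2) sB by (intro independent_insertI) auto
  interpret vp: vector_space_pair scale "(*) :: 'a \<Rightarrow> 'a \<Rightarrow> 'a"
    by (simp add: vector_space_pair_def vector_space_axioms vector_space_mult)
  obtain \<phi> where \<phi>: "Vector_Spaces.linear scale (*) \<phi>"
      "\<forall>x\<in>insert v B. \<phi> x = (if x = v then 1 else 0)"
    using vp.linear_independent_extend[OF ind, of "\<lambda>x. if x = v then 1 else 0"] by blast
  have "v \<notin> B" using assms B by auto
  have "\<phi> x = 0" if "x \<in> M" for x
    using that unfolding sB[symmetric]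
    using vp.linear_eq_0_on_span[OF \<phi>(1), of B x] \<phi>(2) \<open>v \<notin> B\<close>
    by (metis insert_iff)
  with \<phi> show thesis using that[of \<phi>] by auto
qed


section \<open>Coordinates on tensor powers\<close>

text \<open>Independence is stated for indexed coefficients, which also forces \<open>x\<close> to
  be injective on \<open>G\<close>.\<close>

locale finite_basis = vector_space scale
  for scale :: "'k::field \<Rightarrow> 'a::ab_group_add \<Rightarrow> 'a" +
  fixes G :: "'g set" and x :: "'g \<Rightarrow> 'a"
  assumes finite_index: "finite G"
    and spanning: "\<And>a. \<exists>c. a = (\<Sum>g\<in>G. scale (c g) (x g))"
    and independence: "\<And>c g. (\<Sum>g\<in>G. scale (c g) (x g)) = 0 \<Longrightarrow> g \<in> G \<Longrightarrow> c g = 0"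
begin

text \<open>The chosen family is unique on \<open>G\<close> by independence but arbitrary elsewhere;
  hence the condition \<open>g \<in> G\<close> in the lemmas on single coefficients.\<close>

definition coef :: "'g \<Rightarrow> 'a \<Rightarrow> 'k" where
  "coef g a = (SOME c. a = (\<Sum>g\<in>G. scale (c g) (x g))) g"

lemma sum_coef: "(\<Sum>g\<in>G. scale (coef g a) (x g)) = a"
  unfolding coef_def using someI_ex[OF spanning[of a]] by simp

lemma coef_unique:
  assumes "(\<Sum>g\<in>G. scale (c g) (x g)) = (\<Sum>g\<in>G. scale (d g) (x g))" "g \<in> G"
  shows "c g = d g"
  using independence[of "\<lambda>g. c g - d g" g] assms
  by (simp add: scale_left_diff_distrib sum_subtractf)

lemma coef_sum: "g \<in> G \<Longrightarrow> coef g (\<Sum>h\<in>G. scale (c h) (x h)) = c g"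
  by (rule coef_unique[of "\<lambda>g. coef g (\<Sum>h\<in>G. scale (c h) (x h))"]) (simp_all add: sum_coef)

lemma coef_x: "g \<in> G \<Longrightarrow> h \<in> G \<Longrightarrow> coef g (x h) = (if g = h then 1 else 0)"
  using coef_sum[of g "\<lambda>g. if g = h then 1 else 0"] finite_index
  by (simp add: if_distrib[of "\<lambda>c. scale c _"] cong: if_cong)

lemma coef_add: "g \<in> G \<Longrightarrow> coef g (a + b) = coef g a + coef g b"
  by (rule coef_unique[of "\<lambda>g. coef g (a + b)"])
     (simp_all add: sum_coef scale_left_distrib sum.distrib)

lemma coef_scale: "g \<in> G \<Longrightarrow> coef g (scale c a) = c * coef g a"
  by (rule coef_unique[of "\<lambda>g. coef g (scale c a)"])
     (simp_all add: sum_coef scale_sum_right[symmetric] scale_scale[symmetric] del: scale_scale)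

lemma linear_coef: "g \<in> G \<Longrightarrow> Vector_Spaces.linear scale (*) (coef g)"
  by (intro linearI vector_space_axioms vector_space_mult coef_add coef_scale)

lemma linear_expand:
  assumes "Vector_Spaces.linear scale s f"
  shows "f a = (\<Sum>g\<in>G. s (coef g a) (f (x g)))"
proof -
  have "f a = f (\<Sum>g\<in>G. scale (coef g a) (x g))"
    by (simp add: sum_coef)
  then show ?thesis
    by (simp add: linear_sumD[OF assms] linear_scaleD[OF assms])
qed

definition bilin :: "('k \<Rightarrow> 'v \<Rightarrow> 'v::ab_group_add) \<Rightarrow> ('a \<Rightarrow> 'a \<Rightarrow> 'v) \<Rightarrow> bool" where
  "bilin s f \<longleftrightarrow> (\<forall>b. Vector_Spaces.linear scale s (\<lambda>a. f a b)) \<and>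
     (\<forall>a. Vector_Spaces.linear scale s (f a))"

definition trilin :: "('k \<Rightarrow> 'v \<Rightarrow> 'v::ab_group_add) \<Rightarrow> ('a \<Rightarrow> 'a \<Rightarrow> 'a \<Rightarrow> 'v) \<Rightarrow> bool" where
  "trilin s f \<longleftrightarrow> (\<forall>b c. Vector_Spaces.linear scale s (\<lambda>a. f a b c)) \<and>
     (\<forall>a c. Vector_Spaces.linear scale s (\<lambda>b. f a b c)) \<and>
     (\<forall>a b. Vector_Spaces.linear scale s (f a b))"

lemma bilinI:
  assumes "vector_space s"
    and "\<And>a a' b. f (a + a') b = f a b + f a' b" "\<And>c a b. f (scale c a) b = s c (f a b)"
    and "\<And>a b b'. f a (b + b') = f a b + f a b'" "\<And>c a b. f a (scale c b) = s c (f a b)"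
  shows "bilin s f"
  unfolding bilin_def using assms by (auto intro!: linearI vector_space_axioms)

text \<open>The coordinate of the class of \<open>s\<close> at \<open>x g \<otimes> x h\<close>,
  computed on a representative in the free space on pairs.\<close>

definition co2 :: "('a \<times> 'a \<Rightarrow>\<^sub>0 'k) \<Rightarrow> 'g \<Rightarrow> 'g \<Rightarrow> 'k" where
  "co2 s g h = lin_ext (*) (\<lambda>(a, b). coef g a * coef h b) s"

definition co3 :: "('a \<times> 'a \<times> 'a \<Rightarrow>\<^sub>0 'k) \<Rightarrow> 'g \<Rightarrow> 'g \<Rightarrow> 'g \<Rightarrow> 'k" where
  "co3 s g h k = lin_ext (*) (\<lambda>(a, b, c). coef g a * coef h b * coef k c) s"

lemmas kmult_lin_ext_add = vector_space.lin_ext_add[OF vector_space_mult]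
  and kmult_lin_ext_fscale = vector_space.lin_ext_fscale[OF vector_space_mult]
  and kmult_lin_ext_diff = vector_space.lin_ext_diff[OF vector_space_mult]
  and kmult_lin_ext_zero = vector_space.lin_ext_zero[OF vector_space_mult]
  and kmult_lin_ext_single = vector_space.lin_ext_single[OF vector_space_mult]

lemma linear_co2: "Vector_Spaces.linear fscale (*) (\<lambda>s. co2 s g h)"
  unfolding co2_def by (rule vector_space.linear_lin_ext[OF vector_space_mult])

lemma linear_co3: "Vector_Spaces.linear fscale (*) (\<lambda>s. co3 s g h k)"
  unfolding co3_def by (rule vector_space.linear_lin_ext[OF vector_space_mult])

lemmas co2_add = linear_addD[OF linear_co2] and co2_fscale = linear_scaleD[OF linear_co2]
  and co2_sum = linear_sumD[OF linear_co2]
  and co3_sum = linear_sumD[OF linear_co3]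

lemma co2_diff: "co2 (s - t) g h = co2 s g h - co2 t g h"
  by (simp add: co2_def kmult_lin_ext_diff)

lemma co3_diff: "co3 (s - t) g h k = co3 s g h k - co3 t g h k"
  by (simp add: co3_def kmult_lin_ext_diff)

lemma co2_single: "co2 (Poly_Mapping.single (a, b) c) g h = c * (coef g a * coef h b)"
  by (simp add: co2_def kmult_lin_ext_single)

lemma co3_single: "co3 (Poly_Mapping.single (a, b, d) c) g h k = c * (coef g a * coef h b * coef k d)"
  by (simp add: co3_def kmult_lin_ext_single)

text \<open>Expanding both arguments in the basis and interchanging finite sums collects the scalars
  into \<open>co2\<close>. A bilinear map thus sees a formal combination only through its
  coordinates.\<close>

lemma lin_ext_bilin:
  assumes "bilin s f"
  shows "lin_ext s (\<lambda>(a, b). f a b) p = (\<Sum>g\<in>G. \<Sum>h\<in>G. s (co2 p g h) (f (x g) (x h)))"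
proof -
  have vs: "vector_space s" using assms unfolding bilin_def by (blast dest: linear_vs2)
  interpret s: vector_space s by fact
  have expand: "f a b = (\<Sum>g\<in>G. \<Sum>h\<in>G. s (coef g a * coef h b) (f (x g) (x h)))" for a b
  proof -
    have "f a b = (\<Sum>g\<in>G. s (coef g a) (f (x g) b))"
      using assms unfolding bilin_def by (intro linear_expand) auto
    also have "\<dots> = (\<Sum>g\<in>G. s (coef g a) (\<Sum>h\<in>G. s (coef h b) (f (x g) (x h))))"
      using assms unfolding bilin_def by (intro sum.cong refl arg_cong[of _ _ "s _"] linear_expand) auto
    finally show ?thesis by (simp add: s.scale_sum_right)
  qed
  have "lin_ext s (\<lambda>(a, b). f a b) p =
      (\<Sum>y\<in>Poly_Mapping.keys p. \<Sum>g\<in>G. \<Sum>h\<in>G.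
         s (Poly_Mapping.lookup p y * (coef g (fst y) * coef h (snd y))) (f (x g) (x h)))"
    unfolding lin_ext_def case_prod_beta
    by (subst expand) (simp only: s.scale_sum_right s.scale_scale)
  also have "\<dots> = (\<Sum>g\<in>G. \<Sum>h\<in>G. \<Sum>y\<in>Poly_Mapping.keys p.
         s (Poly_Mapping.lookup p y * (coef g (fst y) * coef h (snd y))) (f (x g) (x h)))"
    by (simp only: sum.swap[where A = "Poly_Mapping.keys p"])
  also have "\<dots> = (\<Sum>g\<in>G. \<Sum>h\<in>G. s (co2 p g h) (f (x g) (x h)))"
    by (simp only: co2_def lin_ext_def case_prod_beta s.scale_sum_left)
  finally show ?thesis .
qed

lemma lin_ext_trilin:
  assumes "trilin s f"
  shows "lin_ext s (\<lambda>(a, b, c). f a b c) p =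
    (\<Sum>g\<in>G. \<Sum>h\<in>G. \<Sum>k\<in>G. s (co3 p g h k) (f (x g) (x h) (x k)))"
proof -
  have vs: "vector_space s" using assms unfolding trilin_def by (blast dest: linear_vs2)
  interpret s: vector_space s by fact
  have expand: "f a b c = (\<Sum>g\<in>G. \<Sum>h\<in>G. \<Sum>k\<in>G. s (coef g a * coef h b * coef k c) (f (x g) (x h) (x k)))"
    for a b c
  proof -
    have "f a b c = (\<Sum>g\<in>G. s (coef g a) (f (x g) b c))"
      using assms unfolding trilin_def by (intro linear_expand[of s "\<lambda>a. f a b c"]) auto
    also have "\<dots> = (\<Sum>g\<in>G. s (coef g a) (\<Sum>h\<in>G. s (coef h b) (f (x g) (x h) c)))"
      using assms unfolding trilin_def
      by (intro sum.cong refl arg_cong[of _ _ "s _"] linear_expand[of s "\<lambda>b. f _ b c"]) auto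
    also have "\<dots> = (\<Sum>g\<in>G. s (coef g a) (\<Sum>h\<in>G. s (coef h b) (\<Sum>k\<in>G. s (coef k c) (f (x g) (x h) (x k)))))"
      using assms unfolding trilin_def
      by (intro sum.cong refl arg_cong[of _ _ "s _"] linear_expand[of s "f _ _"]) auto
    finally show ?thesis by (simp add: s.scale_sum_right mult.assoc)
  qed
  have "lin_ext s (\<lambda>(a, b, c). f a b c) p =
      (\<Sum>y\<in>Poly_Mapping.keys p. \<Sum>g\<in>G. \<Sum>h\<in>G. \<Sum>k\<in>G.
         s (Poly_Mapping.lookup p y * (coef g (fst y) * coef h (fst (snd y)) * coef k (snd (snd y))))
           (f (x g) (x h) (x k)))"
    unfolding lin_ext_def case_prod_beta
    by (subst expand) (simp only: s.scale_sum_right s.scale_scale)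
  also have "\<dots> = (\<Sum>g\<in>G. \<Sum>h\<in>G. \<Sum>k\<in>G. \<Sum>y\<in>Poly_Mapping.keys p.
         s (Poly_Mapping.lookup p y * (coef g (fst y) * coef h (fst (snd y)) * coef k (snd (snd y))))
           (f (x g) (x h) (x k)))"
    by (simp only: sum.swap[where A = "Poly_Mapping.keys p"])
  also have "\<dots> = (\<Sum>g\<in>G. \<Sum>h\<in>G. \<Sum>k\<in>G. s (co3 p g h k) (f (x g) (x h) (x k)))"
    by (simp only: co3_def lin_ext_def case_prod_beta s.scale_sum_left)
  finally show ?thesis .
qed

lemma subspace_multilinear_relations: "fscale.subspace (multilinear_relations scale \<Sigma>)"
  unfolding multilinear_relations_def by (rule fscale.subspace_span)

text \<open>The combinations killed by the extension of \<open>\<phi>\<close> form a subspace, and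
  linearity along each slot puts both kinds of generators into it.\<close>

lemma lin_ext_multilinear_relations:
  assumes "\<And>\<sigma>. \<sigma> \<in> \<Sigma> \<Longrightarrow> Vector_Spaces.linear scale (*) (\<lambda>u. \<phi> (\<sigma> u))"
    and "r \<in> multilinear_relations scale \<Sigma>"
  shows "lin_ext (*) \<phi> r = 0"
  using assms(2) unfolding multilinear_relations_def
proof (induction rule: fscale.span_induct)
  case base
  show ?case
    by (auto simp: fscale.subspace_def kmult_lin_ext_zero kmult_lin_ext_add kmult_lin_ext_fscale)
next
  case (step r)
  then show ?case
    using linear_addD[OF assms(1)] linear_scaleD[OF assms(1)]
    by (auto simp: kmult_lin_ext_diff kmult_lin_ext_single)
qed

text \<open>Vanishing on the two kinds of generators gives additivity and homogeneity in the chosen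
  slot: functionals on the quotient are multilinear maps.\<close>

lemma multilinear_functional:
  assumes "Vector_Spaces.linear fscale (*) \<phi>"
    and "\<forall>r\<in>multilinear_relations scale \<Sigma>. \<phi> r = 0" and "\<sigma> \<in> \<Sigma>"
  shows "Vector_Spaces.linear scale (*) (\<lambda>u. \<phi> (Poly_Mapping.single (\<sigma> u) 1))"
proof (rule linearI)
  interpret \<phi>: Vector_Spaces.linear fscale "(*)" \<phi> by fact
  fix u v c
  have "Poly_Mapping.single (\<sigma> (u + v)) 1 - Poly_Mapping.single (\<sigma> u) 1 - Poly_Mapping.single (\<sigma> v) 1
      \<in> multilinear_relations scale \<Sigma>"
    unfolding multilinear_relations_def using assms(3) by (intro fscale.span_base) blast
  from assms(2)[rule_format, OF this] show "\<phi> (Poly_Mapping.single (\<sigma> (u + v)) 1) =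
      \<phi> (Poly_Mapping.single (\<sigma> u) 1) + \<phi> (Poly_Mapping.single (\<sigma> v) 1)"
    by (simp add: \<phi>.diff \<phi>.add algebra_simps)
  have "Poly_Mapping.single (\<sigma> (scale c u)) 1 - Poly_Mapping.single (\<sigma> u) c
      \<in> multilinear_relations scale \<Sigma>"
    unfolding multilinear_relations_def using assms(3) by (intro fscale.span_base) blast
  from assms(2)[rule_format, OF this] show "\<phi> (Poly_Mapping.single (\<sigma> (scale c u)) 1) =
      c * \<phi> (Poly_Mapping.single (\<sigma> u) 1)"
    using \<phi>.scale[of c "Poly_Mapping.single (\<sigma> u) 1"] by (simp add: \<phi>.diff)
qed (use vector_space_axioms vector_space_mult in auto)

lemma functional_eq_lin_ext:
  assumes "Vector_Spaces.linear fscale (*) \<phi>"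
  shows "\<phi> p = lin_ext (*) (\<lambda>y. \<phi> (Poly_Mapping.single y 1)) p"
proof -
  have "\<phi> p = \<phi> (\<Sum>y\<in>Poly_Mapping.keys p. fscale (Poly_Mapping.lookup p y) (Poly_Mapping.single y 1))"
    using poly_mapping_eq_sum_single[of p] by simp
  then show ?thesis
    unfolding lin_ext_def linear_sumD[OF assms] linear_scaleD[OF assms] .
qed

abbreviation slots2 :: "('a \<Rightarrow> 'a \<times> 'a) set" where
  "slots2 \<equiv> {\<lambda>u. (u, b) | b. True} \<union> {\<lambda>u. (a, u) | a. True}"

abbreviation slots3 :: "('a \<Rightarrow> 'a \<times> 'a \<times> 'a) set" where
  "slots3 \<equiv> {\<lambda>u. (u, b, c) | b c. True} \<union> {\<lambda>u. (a, u, c) | a c. True} \<union> {\<lambda>u. (a, b, u) | a b. True}"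

text \<open>For the nontrivial direction, a functional vanishing on the multilinearity relations is a
  multilinear map, hence is determined by its values on basis tuples.\<close>

lemma multilinear_relations2_iff:
  "r \<in> multilinear_relations scale slots2 \<longleftrightarrow> (\<forall>g\<in>G. \<forall>h\<in>G. co2 r g h = 0)"
proof (intro iffI ballI)
  fix g h assume "r \<in> multilinear_relations scale slots2" "g \<in> G" "h \<in> G"
  note r = this
  show "co2 r g h = 0"
    unfolding co2_def
  proof (rule lin_ext_multilinear_relations[OF _ r(1)])
    fix \<sigma> assume "\<sigma> \<in> slots2"
    then consider b where "\<sigma> = (\<lambda>u. (u, b))" | a where "\<sigma> = (\<lambda>u. (a, u))"
      by blast
    then show "Vector_Spaces.linear scale (*) (\<lambda>u. case \<sigma> u of (a, b) \<Rightarrow> coef g a * coef h b)"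
      by cases (simp_all add: Vector_Spaces.linear_iff vector_space_axioms vector_space_mult r
          coef_add coef_scale distrib_left distrib_right)
  qed
next
  assume 0: "\<forall>g\<in>G. \<forall>h\<in>G. co2 r g h = 0"
  show "r \<in> multilinear_relations scale slots2"
  proof (rule ccontr)
    assume "r \<notin> multilinear_relations scale slots2"
    then obtain \<phi> where \<phi>: "Vector_Spaces.linear fscale (*) \<phi>"
      "\<forall>x\<in>multilinear_relations scale slots2. \<phi> x = 0" "\<phi> r = 1"
      by (rule fscale.exists_functional[OF subspace_multilinear_relations])
    note lin = multilinear_functional[OF \<phi>(1,2)]
    have "bilin (*) (\<lambda>a b. \<phi> (Poly_Mapping.single (a, b) 1))"
      unfolding bilin_def
      by (intro conjI allI lin[of "\<lambda>u. (u, _)"] lin[of "\<lambda>u. (_, u)"]) blast+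
    from lin_ext_bilin[OF this, of r] have "\<phi> r = 0"
      using 0 functional_eq_lin_ext[OF \<phi>(1), of r] by (simp add: case_prod_beta')
    with \<phi>(3) show False by simp
  qed
qed

lemma multilinear_relations3_iff:
  "r \<in> multilinear_relations scale slots3 \<longleftrightarrow> (\<forall>g\<in>G. \<forall>h\<in>G. \<forall>k\<in>G. co3 r g h k = 0)"
proof (intro iffI ballI)
  fix g h k assume "r \<in> multilinear_relations scale slots3" "g \<in> G" "h \<in> G" "k \<in> G"
  note r = this
  show "co3 r g h k = 0"
    unfolding co3_def
  proof (rule lin_ext_multilinear_relations[OF _ r(1)])
    fix \<sigma> assume "\<sigma> \<in> slots3"
    then consider b c where "\<sigma> = (\<lambda>u. (u, b, c))" | a c where "\<sigma> = (\<lambda>u. (a, u, c))"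
        | a b where "\<sigma> = (\<lambda>u. (a, b, u))"
      by blast
    then show "Vector_Spaces.linear scale (*)
        (\<lambda>u. case \<sigma> u of (a, b, c) \<Rightarrow> coef g a * coef h b * coef k c)"
      by cases (simp_all add: Vector_Spaces.linear_iff vector_space_axioms vector_space_mult r
          coef_add coef_scale distrib_left distrib_right)
  qed
next
  assume 0: "\<forall>g\<in>G. \<forall>h\<in>G. \<forall>k\<in>G. co3 r g h k = 0"
  show "r \<in> multilinear_relations scale slots3"
  proof (rule ccontr)
    assume "r \<notin> multilinear_relations scale slots3"
    then obtain \<phi> where \<phi>: "Vector_Spaces.linear fscale (*) \<phi>"
      "\<forall>x\<in>multilinear_relations scale slots3. \<phi> x = 0" "\<phi> r = 1"
      by (rule fscale.exists_functional[OF subspace_multilinear_relations])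
    note lin = multilinear_functional[OF \<phi>(1,2)]
    have "trilin (*) (\<lambda>a b c. \<phi> (Poly_Mapping.single (a, b, c) 1))"
      unfolding trilin_def
      by (intro conjI allI lin[of "\<lambda>u. (u, _, _)"] lin[of "\<lambda>u. (_, u, _)"]
          lin[of "\<lambda>u. (_, _, u)"]) blast+
    from lin_ext_trilin[OF this, of r] have "\<phi> r = 0"
      using 0 functional_eq_lin_ext[OF \<phi>(1), of r] by (simp add: case_prod_beta')
    with \<phi>(3) show False by simp
  qed
qed

lemma tensor2_rel_iff: "(s, t) \<in> tensor2_rel scale \<longleftrightarrow> (\<forall>g\<in>G. \<forall>h\<in>G. co2 s g h = co2 t g h)"
  by (simp only: tensor2_rel_def mem_Collect_eq case_prod_conv multilinear_relations2_iff co2_diff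
      right_minus_eq)

lemma tensor3_rel_iff:
  "(s, t) \<in> tensor3_rel scale \<longleftrightarrow> (\<forall>g\<in>G. \<forall>h\<in>G. \<forall>k\<in>G. co3 s g h k = co3 t g h k)"
  by (simp only: tensor3_rel_def mem_Collect_eq case_prod_conv multilinear_relations3_iff co3_diff
      right_minus_eq)

lemma mem_tensor2_iff: "t \<in> tensor2 scale s \<longleftrightarrow> (\<forall>g\<in>G. \<forall>h\<in>G. co2 s g h = co2 t g h)"
  by (simp add: tensor2_def tensor2_rel_iff)

lemma tensor3_eq_iff:
  "tensor3 scale s = tensor3 scale t \<longleftrightarrow> (\<forall>g\<in>G. \<forall>h\<in>G. \<forall>k\<in>G. co3 s g h k = co3 t g h k)"
  by (auto simp: tensor3_def tensor3_rel_iff set_eq_iff)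

lemma tensor2_in_space [simp]: "tensor2 scale s \<in> tensor2_space scale"
  by (auto simp: tensor2_space_def tensor2_def intro: quotientI)

text \<open>The representative is chosen by the same \<open>SOME\<close> as in
  \<open>sweedler\<close>, so \<open>sweedler_bilin\<close> holds by unfolding. For indices in
  \<open>G\<close>, \<open>co_tensor_tensor2\<close> shows that the choice does not affect the
  value.\<close>

definition co_tensor :: "('k, 'a) tensor2 \<Rightarrow> 'g \<Rightarrow> 'g \<Rightarrow> 'k" where
  "co_tensor T g h = co2 (SOME s. s \<in> T) g h"

lemma co_tensor_tensor2: "g \<in> G \<Longrightarrow> h \<in> G \<Longrightarrow> co_tensor (tensor2 scale s) g h = co2 s g h"
  unfolding co_tensor_def
  using someI[of "\<lambda>t. t \<in> tensor2 scale s" s] by (simp add: mem_tensor2_iff)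

lemma tensor2_spaceE:
  assumes "T \<in> tensor2_space scale"
  obtains s where "T = tensor2 scale s"
  using assms by (auto simp: tensor2_space_def tensor2_def elim: quotientE)

lemma mem_tensor2_space_iff:
  assumes "T \<in> tensor2_space scale"
  shows "s \<in> T \<longleftrightarrow> (\<forall>g\<in>G. \<forall>h\<in>G. co2 s g h = co_tensor T g h)"
  using assms by (auto elim!: tensor2_spaceE simp: mem_tensor2_iff co_tensor_tensor2)

lemma tensor2_space_eqI:
  assumes "T \<in> tensor2_space scale" "T' \<in> tensor2_space scale"
    and "\<And>g h. g \<in> G \<Longrightarrow> h \<in> G \<Longrightarrow> co_tensor T g h = co_tensor T' g h"
  shows "T = T'"
  using assms by (auto simp: mem_tensor2_space_iff)

lemma sweedler_bilin:
  assumes "bilin s f"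
  shows "sweedler s T f = (\<Sum>g\<in>G. \<Sum>h\<in>G. s (co_tensor T g h) (f (x g) (x h)))"
  unfolding sweedler_def lin_ext_bilin[OF assms] co_tensor_def ..

text \<open>Bilinearity is required only after passing to a coordinate, because \<open>f\<close>
  takes values in formal combinations and is in general bilinear only modulo the multilinearity
  relations.\<close>

lemma co2_sweedler:
  assumes "bilin (*) (\<lambda>a b. co2 (f a b) g h)"
  shows "co2 (sweedler fscale T f) g h = (\<Sum>u\<in>G. \<Sum>v\<in>G. co_tensor T u v * co2 (f (x u) (x v)) g h)"
  using sweedler_bilin[OF assms, of T]
  unfolding sweedler_def linear_comp_lin_ext[OF linear_co2] by (simp add: case_prod_beta')

lemma co3_sweedler:
  assumes "bilin (*) (\<lambda>a b. co3 (f a b) g h k)"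
  shows "co3 (sweedler fscale T f) g h k =
    (\<Sum>u\<in>G. \<Sum>v\<in>G. co_tensor T u v * co3 (f (x u) (x v)) g h k)"
  using sweedler_bilin[OF assms, of T]
  unfolding sweedler_def linear_comp_lin_ext[OF linear_co3] by (simp add: case_prod_beta')

end

section \<open>The group of degrees\<close>

lemma finite_Znm: "finite (Znm n m)"
  by (simp add: Znm_def finite_PiE)

lemma card_Znm: "card (Znm n m) = n ^ m"
  by (simp add: Znm_def card_PiE)

lemma Znm_eqI:
  assumes "g \<in> Znm n m" "h \<in> Znm n m" "\<And>i. i \<in> {1..m} \<Longrightarrow> g i = h i"
  shows "g = h"
  using assms unfolding Znm_def by (intro PiE_ext)

lemma Znm_less: "g \<in> Znm n m \<Longrightarrow> i \<in> {1..m} \<Longrightarrow> g i < n"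
  by (auto simp: Znm_def dest: PiE_mem)

lemma add_Znm_commute: "add_Znm n m g h = add_Znm n m h g"
  by (simp add: add_Znm_def add.commute)

lemma add_Znm_assoc: "add_Znm n m (add_Znm n m g h) k = add_Znm n m g (add_Znm n m h k)"
  by (rule ext) (simp add: add_Znm_def restrict_def mod_simps add.assoc)

lemma add_Znm_left_commute: "add_Znm n m g (add_Znm n m h k) = add_Znm n m h (add_Znm n m g k)"
  by (metis add_Znm_assoc add_Znm_commute)

lemmas add_Znm_ac = add_Znm_assoc add_Znm_commute add_Znm_left_commute

lemma zero_in_Znm: "n > 0 \<Longrightarrow> zero_Znm m \<in> Znm n m"
  by (auto simp: zero_Znm_def Znm_def)

lemma add_in_Znm: "n > 0 \<Longrightarrow> add_Znm n m g h \<in> Znm n m"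
  by (auto simp: add_Znm_def Znm_def)

lemma diff_in_Znm: "n > 0 \<Longrightarrow> diff_Znm n m g h \<in> Znm n m"
  by (auto simp: diff_Znm_def Znm_def nat_less_iff)

lemma add_zero_Znm: "g \<in> Znm n m \<Longrightarrow> add_Znm n m (zero_Znm m) g = g"
  by (auto simp: add_Znm_def zero_Znm_def Znm_def fun_eq_iff restrict_def PiE_def Pi_def extensional_def)

lemma add_eq_iff_diff_Znm:
  assumes "n > 0" "g \<in> Znm n m" "k \<in> Znm n m"
  shows "add_Znm n m h k = g \<longleftrightarrow> k = diff_Znm n m g h"
proof
  assume eq: "add_Znm n m h k = g"
  show "k = diff_Znm n m g h"
  proof (rule Znm_eqI[OF assms(3) diff_in_Znm[OF assms(1)]])
    fix i assume i: "i \<in> {1..m}"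
    have "(int ((h i + k i) mod n) - int (h i)) mod int n = int (k i)"
      using Znm_less[OF assms(3) i] by (simp add: of_nat_mod mod_simps)
    then show "k i = diff_Znm n m g h i"
      using i by (simp add: diff_Znm_def add_Znm_def eq[symmetric])
  qed
next
  assume eq: "k = diff_Znm n m g h"
  show "add_Znm n m h k = g"
  proof (rule Znm_eqI[OF add_in_Znm[OF assms(1)] assms(2)])
    fix i assume i: "i \<in> {1..m}"
    have "int ((h i + nat ((int (g i) - int (h i)) mod int n)) mod n) = int (g i)"
      using Znm_less[OF assms(2) i] assms(1) by (simp add: of_nat_mod mod_simps)
    then show "add_Znm n m h k i = g i"
      using i by (simp add: diff_Znm_def add_Znm_def eq)
  qed
qed


section \<open>Twisted group algebras\<close>

lemma mult_if_zero:
  "(if P then a else 0) * b = (if P then a * b else (0 :: 'b::mult_zero))"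
  "b * (if P then a else 0) = (if P then b * a else (0 :: 'b::mult_zero))"
  by auto

lemma k_algebra_mult_scale:
  assumes "k_algebra scale"
  shows "scale c a * b = scale c (a * b)" and "a * scale c b = scale c (a * b)"
  using assms unfolding k_algebra_def by metis+

lemma sum_if_const: "(\<Sum>i\<in>A. if P then f i else 0) = (if P then sum f A else 0)"
  by simp

text \<open>About \<open>F\<close>, only the multiplication rule and nonvanishing are assumed. Its
  cocycle identity and normalisation follow from associativity and the unit law of the ring.\<close>

locale twisted_group_algebra = finite_basis scale "Znm n m" x
  for scale :: "'k::field \<Rightarrow> 'a::ring_1 \<Rightarrow> 'a" and n m :: nat and x :: "(nat \<Rightarrow> nat) \<Rightarrow> 'a" +
  fixes F :: "(nat \<Rightarrow> nat) \<Rightarrow> (nat \<Rightarrow> nat) \<Rightarrow> 'k"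
  assumes n_pos: "n > 0"
    and k_algebra: "k_algebra scale"
    and x_zero: "x (zero_Znm m) = 1"
    and x_mult: "\<And>g h. g \<in> Znm n m \<Longrightarrow> h \<in> Znm n m \<Longrightarrow> x g * x h = scale (F g h) (x (add_Znm n m g h))"
    and F_nonzero: "\<And>g h. g \<in> Znm n m \<Longrightarrow> h \<in> Znm n m \<Longrightarrow> F g h \<noteq> 0"
begin

abbreviation G where "G \<equiv> Znm n m"
abbreviation padd (infixl "\<oplus>" 65) where "g \<oplus> h \<equiv> add_Znm n m g h"
abbreviation pdiff (infixl "\<ominus>" 65) where "g \<ominus> h \<equiv> diff_Znm n m g h"
abbreviation pzero ("\<zero>") where "\<zero> \<equiv> zero_Znm m"
abbreviation R where "R \<equiv> braiding_of F"

definition H :: "(nat \<Rightarrow> nat) \<Rightarrow> 'a set" where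
  "H g = {scale c (x g) | c. True}"

lemmas [simp] = finite_Znm zero_in_Znm[OF n_pos] add_in_Znm[OF n_pos] diff_in_Znm[OF n_pos]
  add_zero_Znm F_nonzero

lemma add_zero_right [simp]: "g \<in> G \<Longrightarrow> g \<oplus> \<zero> = g"
  by (metis add_Znm_commute add_zero_Znm)

lemma add_eq_iff: "g \<in> G \<Longrightarrow> k \<in> G \<Longrightarrow> h \<oplus> k = g \<longleftrightarrow> k = g \<ominus> h"
  by (rule add_eq_iff_diff_Znm[OF n_pos])

lemma add_diff [simp]: "g \<in> G \<Longrightarrow> h \<oplus> (g \<ominus> h) = g"
  by (simp add: add_eq_iff)

lemma diff_add [simp]: "g \<in> G \<Longrightarrow> (g \<ominus> h) \<oplus> h = g"
  by (metis add_Znm_commute add_diff)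

lemma diff_eqI: "h \<oplus> k = g \<Longrightarrow> k \<in> G \<Longrightarrow> g \<ominus> h = k"
  by (metis add_eq_iff add_in_Znm n_pos)

lemma diff_add_cancel_Znm [simp]: "k \<in> G \<Longrightarrow> (h \<oplus> k) \<ominus> h = k"
  by (rule diff_eqI) auto

lemma diff_diff [simp]: "g \<in> G \<Longrightarrow> h \<in> G \<Longrightarrow> g \<ominus> (g \<ominus> h) = h"
  by (rule diff_eqI) auto

text \<open>A degree constraint selects a single summand; many of the double sums below collapse in
  this way.\<close>

lemma sum_add_eq:
  assumes "g \<in> G"
  shows "(\<Sum>k\<in>G. if h \<oplus> k = g then f k else 0) = (f (g \<ominus> h) :: 'b::comm_monoid_add)"
proof -
  have "(\<Sum>k\<in>G. if h \<oplus> k = g then f k else 0) = (\<Sum>k\<in>G. if k = g \<ominus> h then f k else 0)"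
    using assms by (intro sum.cong) (auto simp: add_eq_iff)
  then show ?thesis by simp
qed

lemma sum_translate: "h \<in> G \<Longrightarrow> (\<Sum>k\<in>G. f (h \<oplus> k)) = (\<Sum>k\<in>G. f k)"
  by (rule sum.reindex_bij_witness[of _ "\<lambda>k. k \<ominus> h" "\<lambda>k. h \<oplus> k"]) auto

lemma sum_reflect: "g \<in> G \<Longrightarrow> (\<Sum>k\<in>G. f (g \<ominus> k)) = (\<Sum>k\<in>G. f k)"
  by (rule sum.reindex_bij_witness[of _ "\<lambda>k. g \<ominus> k" "\<lambda>k. g \<ominus> k"]) auto

lemmas mult_scale [simp] = k_algebra_mult_scale[OF k_algebra]

lemma coef_mult_x: "g \<in> G \<Longrightarrow> h \<in> G \<Longrightarrow> k \<in> G \<Longrightarrow> coef k (x g * x h) = (if g \<oplus> h = k then F g h else 0)"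
  by (simp add: x_mult coef_scale coef_x)

lemma coef_one: "g \<in> G \<Longrightarrow> coef g 1 = (if g = \<zero> then 1 else 0)"
  using coef_x[of g \<zero>] by (simp add: x_zero)

text \<open>Associativity, read off in the coefficient of degree
  \<open>g \<oplus> h \<oplus> k\<close>.\<close>

lemma cocycle:
  assumes "g \<in> G" "h \<in> G" "k \<in> G"
  shows "F g h * F (g \<oplus> h) k = F h k * F g (h \<oplus> k)"
proof -
  have "coef (g \<oplus> h \<oplus> k) (x g * x h * x k) = coef (g \<oplus> h \<oplus> k) (x g * (x h * x k))"
    by (simp add: mult.assoc)
  then show ?thesis
    using assms by (simp add: x_mult coef_scale coef_x add_Znm_assoc)
qed

lemma F_zero_left [simp]: "g \<in> G \<Longrightarrow> F \<zero> g = 1"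
  using coef_mult_x[of \<zero> g g] coef_x[of g g] by (simp add: x_zero)

lemma F_zero_right [simp]: "g \<in> G \<Longrightarrow> F g \<zero> = 1"
  using coef_mult_x[of g \<zero> g] coef_x[of g g] by (simp add: x_zero)

lemma R_F: "g \<in> G \<Longrightarrow> h \<in> G \<Longrightarrow> R g h * F h g = F g h"
  by (simp add: braiding_of_def)

lemma R_self [simp]: "g \<in> G \<Longrightarrow> R g g = 1"
  by (simp add: braiding_of_def)

text \<open>The two ways of evaluating \<open>x a * x b * x c * x d\<close>, with and without braiding the two
  middle factors.\<close>

lemma four_factors:
  assumes "a \<in> G" "b \<in> G" "c \<in> G" "d \<in> G"
  shows "R b c * (F a c * F b d * F (a \<oplus> c) (b \<oplus> d)) = F a b * F c d * F (a \<oplus> b) (c \<oplus> d)"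
proof -
  \<comment> \<open>This rule and the next are stated for arbitrary arguments since each is also
    applied with \<open>b\<close> and \<open>c\<close> exchanged. After regrouping, the two sides
    differ only in \<open>F c b\<close> against \<open>F b c\<close>, which \<open>R b c\<close>
    converts.\<close>
  have 1: "F a b * F c d * F (a \<oplus> b) (c \<oplus> d) = F a (b \<oplus> (c \<oplus> d)) * F c d * F b (c \<oplus> d)"
    if "a \<in> G" "b \<in> G" "c \<in> G" "d \<in> G" for a b c d
    using cocycle[of a b "c \<oplus> d"] that by (simp add: algebra_simps)
  have 2: "F c d * F b (c \<oplus> d) = F b c * F (b \<oplus> c) d"
    if "b \<in> G" "c \<in> G" "d \<in> G" for b c d
    using cocycle[of b c d] that by (simp add: algebra_simps)
  have "R b c * (F a c * F b d * F (a \<oplus> c) (b \<oplus> d)) =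
      R b c * (F a (c \<oplus> (b \<oplus> d)) * (F c b * F (c \<oplus> b) d))"
    unfolding 1[OF assms(1,3,2,4)] by (simp only: 2[OF assms(3,2,4)] mult.assoc)
  also have "\<dots> = F a (b \<oplus> (c \<oplus> d)) * (F b c * F (b \<oplus> c) d)"
    using R_F[of b c] assms
    by (simp add: add_Znm_commute[of n m c b] add_Znm_left_commute[of n m c b] algebra_simps)
  also have "\<dots> = F a b * F c d * F (a \<oplus> b) (c \<oplus> d)"
    unfolding 1[OF assms] by (simp only: 2[OF assms(2-)] mult.assoc)
  finally show ?thesis .
qed

lemma coef_mult:
  assumes "g \<in> G"
  shows "coef g (a * b) = (\<Sum>h\<in>G. coef h a * coef (g \<ominus> h) b * F h (g \<ominus> h))"
proof -
  have "a * b = (\<Sum>h\<in>G. \<Sum>k\<in>G. scale (coef h a * coef k b) (x h * x k))"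
  proof -
    have "a * b = (\<Sum>h\<in>G. scale (coef h a) (x h)) * (\<Sum>k\<in>G. scale (coef k b) (x k))"
      by (simp only: sum_coef)
    then show ?thesis by (simp add: sum_product mult.commute)
  qed
  then have "coef g (a * b) = (\<Sum>h\<in>G. \<Sum>k\<in>G. if h \<oplus> k = g then coef h a * coef k b * F h k else 0)"
    using assms
    by (simp add: linear_sumD[OF linear_coef] coef_scale coef_mult_x if_distrib cong: if_cong)
  then show ?thesis using assms by (simp add: sum_add_eq)
qed


subsection \<open>The grading\<close>

lemma H_iff: "a \<in> H g \<longleftrightarrow> (\<exists>c. a = scale c (x g))"
  by (auto simp: H_def)

text \<open>Every component is spanned by one monomial, so the homogeneous decomposition is the
  basis expansion. This settles uniqueness in \<open>graded_space\<close> and evaluates the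
  \<open>THE\<close> in \<open>component\<close>.\<close>

lemma homogeneous_decomposition_iff:
  "y \<in> (\<Pi>\<^sub>E g\<in>G. H g) \<and> a = (\<Sum>g\<in>G. y g) \<longleftrightarrow> y = (\<lambda>g\<in>G. scale (coef g a) (x g))"
proof
  assume y: "y \<in> (\<Pi>\<^sub>E g\<in>G. H g) \<and> a = (\<Sum>g\<in>G. y g)"
  then have "\<forall>g\<in>G. \<exists>c. y g = scale c (x g)"
    by (auto simp: H_iff[symmetric] dest: PiE_mem)
  then obtain c where c: "\<And>g. g \<in> G \<Longrightarrow> y g = scale (c g) (x g)"
    by metis
  then have "coef g a = c g" if "g \<in> G" for g
    using y that coef_sum[OF that, of c] by simp
  with c y show "y = (\<lambda>g\<in>G. scale (coef g a) (x g))"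
    by (auto simp: fun_eq_iff PiE_def extensional_def)
qed (auto simp: sum_coef H_iff)

lemma component_eq: "g \<in> G \<Longrightarrow> component n m H g a = scale (coef g a) (x g)"
  by (simp add: component_def homogeneous_decomposition_iff)

lemma graded_space: "graded_space n m scale H"
  unfolding graded_space_def homogeneous_decomposition_iff
proof (intro conjI ballI allI)
  show "\<exists>B. finite B \<and> span B = UNIV"
  proof (intro exI conjI)
    have "a \<in> span (x ` G)" for a
      by (subst sum_coef[symmetric]) (auto intro: span_sum span_scale span_base)
    then show "span (x ` G) = UNIV" by auto
  qed simp
  show "subspace (H g)" for g
    unfolding subspace_def
    by (auto simp: H_iff scale_left_distrib[symmetric] intro: exI[of _ 0])
qed (auto intro: vector_space_axioms)

lemma graded_algebra: "graded_algebra n m scale H"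
  unfolding graded_algebra_def
  using graded_space k_algebra by (auto simp: H_iff x_mult)


subsection \<open>Sweedler sums in coordinates\<close>

definition tensor_linear :: "('a \<Rightarrow> ('k, 'a) tensor2) \<Rightarrow> bool" where
  "tensor_linear \<Delta> \<longleftrightarrow> (\<forall>a. \<Delta> a \<in> tensor2_space scale) \<and>
     (\<forall>g\<in>G. \<forall>h\<in>G. Vector_Spaces.linear scale (*) (\<lambda>a. co_tensor (\<Delta> a) g h))"

text \<open>The right-hand side is how \<open>graded_coalgebra\<close> phrases linearity. Membership
  in a class means equality of all coordinates, so in coordinates it becomes ordinary
  linearity.\<close>

lemma tensor_linear_iff:
  "tensor_linear \<Delta> \<longleftrightarrow> (\<forall>a. \<Delta> a \<in> tensor2_space scale) \<and>
     (\<forall>a b. \<forall>s\<in>\<Delta> a. \<forall>t\<in>\<Delta> b. s + t \<in> \<Delta> (a + b)) \<and>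
     (\<forall>c a. \<forall>s\<in>\<Delta> a. fscale c s \<in> \<Delta> (scale c a))" (is "_ \<longleftrightarrow> ?R")
proof
  assume "tensor_linear \<Delta>"
  then show ?R
    by (auto simp: tensor_linear_def mem_tensor2_space_iff co2_add co2_fscale linear_addD linear_scaleD
        Vector_Spaces.linear_iff)
next
  assume R: ?R
  then have sp: "\<And>a. \<Delta> a \<in> tensor2_space scale" by simp
  have "\<forall>a. \<exists>r. \<Delta> a = tensor2 scale r"
    using tensor2_spaceE[OF sp] by blast
  then obtain rep where rep: "\<And>a. \<Delta> a = tensor2 scale (rep a)"
    by metis
  have mem: "rep a \<in> \<Delta> a" for a
    by (simp add: rep mem_tensor2_iff)
  have "rep a + rep b \<in> tensor2 scale (rep (a + b))" "fscale c (rep a) \<in> tensor2 scale (rep (scale c a))"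
    for a b c using R mem unfolding rep by blast+
  then show "tensor_linear \<Delta>"
    by (simp add: tensor_linear_def Vector_Spaces.linear_iff vector_space_axioms vector_space_mult
        rep co_tensor_tensor2 mem_tensor2_iff co2_add co2_fscale)
qed

text \<open>The inner sum is evaluated first; by linearity of \<open>\<Delta>\<close> its coordinate
  is bilinear in \<open>a\<close> and \<open>b\<close>, which justifies expanding the outer
  sum.\<close>

lemma co3_sweedler_left:
  assumes "tensor_linear \<Delta>" "g \<in> G" "h \<in> G" "k \<in> G"
  shows "co3 (sweedler fscale T (\<lambda>a b. sweedler fscale (\<Delta> a) (\<lambda>a1 a2.
      Poly_Mapping.single (a1, a2, b) 1))) g h k = (\<Sum>u\<in>G. co_tensor T u k * co_tensor (\<Delta> (x u)) g h)"
proof -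
  have inner: "co3 (sweedler fscale (\<Delta> a) (\<lambda>a1 a2. Poly_Mapping.single (a1, a2, b) 1)) g h k =
      co_tensor (\<Delta> a) g h * coef k b" for a b
    using assms(2-)
    by (subst co3_sweedler)
       (auto intro!: bilinI vector_space_mult simp: co3_single coef_add coef_scale coef_x algebra_simps
         mult_if_zero sum_if_const)
  have "bilin (*) (\<lambda>a b. co_tensor (\<Delta> a) g h * coef k b)"
    using assms by (auto intro!: bilinI vector_space_mult
        simp: tensor_linear_def Vector_Spaces.linear_iff coef_add coef_scale algebra_simps)
  then show ?thesis
    using assms by (subst co3_sweedler) (auto simp: inner coef_x mult_if_zero)
qed

lemma co3_sweedler_right:
  assumes "tensor_linear \<Delta>" "g \<in> G" "h \<in> G" "k \<in> G"
  shows "co3 (sweedler fscale T (\<lambda>a b. sweedler fscale (\<Delta> b) (\<lambda>b1 b2.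
      Poly_Mapping.single (a, b1, b2) 1))) g h k = (\<Sum>v\<in>G. co_tensor T g v * co_tensor (\<Delta> (x v)) h k)"
proof -
  have inner: "co3 (sweedler fscale (\<Delta> b) (\<lambda>b1 b2. Poly_Mapping.single (a, b1, b2) 1)) g h k =
      coef g a * co_tensor (\<Delta> b) h k" for a b
    using assms(2-)
    by (subst co3_sweedler)
       (auto intro!: bilinI vector_space_mult simp: co3_single coef_add coef_scale coef_x algebra_simps
         mult_if_zero sum_if_const)
  have "bilin (*) (\<lambda>a b. coef g a * co_tensor (\<Delta> b) h k)"
    using assms by (auto intro!: bilinI vector_space_mult
        simp: tensor_linear_def Vector_Spaces.linear_iff coef_add coef_scale algebra_simps)
  then show ?thesis
    using assms
    by (subst co3_sweedler)
       (simp_all add: inner coef_x mult_if_zero sum_if_const)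
qed

lemma co3_sweedler_middle:
  assumes "g \<in> G" "h \<in> G" "k \<in> G"
  shows "co3 (sweedler fscale S (\<lambda>a b. sweedler fscale T (\<lambda>a' b'.
      Poly_Mapping.single (a, b * a', b') 1))) g h k =
    (\<Sum>v\<in>G. \<Sum>u\<in>G. co_tensor S g v * (co_tensor T u k * coef h (x v * x u)))"
proof -
  have inner: "co3 (sweedler fscale T (\<lambda>a' b'. Poly_Mapping.single (a, b * a', b') 1)) g h k =
      coef g a * (\<Sum>u\<in>G. co_tensor T u k * coef h (b * x u))" for a b
    using assms
    by (subst co3_sweedler)
       (auto intro!: bilinI vector_space_mult sum.cong simp: co3_single coef_add coef_scale coef_x
         algebra_simps mult_if_zero sum_distrib_left)
  have "bilin (*) (\<lambda>a b. coef g a * (\<Sum>u\<in>G. co_tensor T u k * coef h (b * x u)))"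
    using assms by (auto intro!: bilinI vector_space_mult
        simp: coef_add coef_scale algebra_simps sum.distrib sum_distrib_left)
  then show ?thesis
    using assms
    by (subst co3_sweedler)
       (simp_all add: inner coef_x mult_if_zero sum_if_const sum_distrib_left)
qed

text \<open>The value is the one without braiding: monomials commute up to \<open>R\<close>, so the
  inserted factor \<open>R u v\<close> undoes the exchange of the middle factors. Hence the two
  conditions on \<open>\<Delta> 1\<close> coincide in coordinates.\<close>

lemma co3_sweedler_middle_braided:
  assumes "g \<in> G" "h \<in> G" "k \<in> G"
  shows "co3 (sweedler fscale S (\<lambda>a b. sweedler fscale T (\<lambda>a' b'.
      \<Sum>u\<in>G. \<Sum>v\<in>G. Poly_Mapping.single (a, component n m H v a' * component n m H u b, b') (R u v)))) g h k =
    (\<Sum>v\<in>G. \<Sum>u\<in>G. co_tensor S g v * (co_tensor T u k * coef h (x v * x u)))"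
proof -
  have prod: "coef h (a * b) = (\<Sum>u\<in>G. \<Sum>v\<in>G. coef u a * coef v b * coef h (x u * x v))" for a b
  proof -
    have "a * b = (\<Sum>u\<in>G. scale (coef u a) (x u)) * (\<Sum>v\<in>G. scale (coef v b) (x v))"
      by (simp only: sum_coef)
    then show ?thesis
      using assms by (simp add: sum_product linear_sumD[OF linear_coef] coef_scale mult_ac)
  qed
  have "co3 (\<Sum>u\<in>G. \<Sum>v\<in>G. Poly_Mapping.single (a, component n m H v a' * component n m H u b, b') (R u v)) g h k
    = co3 (Poly_Mapping.single (a, b * a', b') 1) g h k" for a b a' b'
    unfolding co3_sum co3_single prod[of b a'] sum_distrib_left sum_distrib_right
  proof (intro sum.cong refl)
    fix u v assume "u \<in> G" "v \<in> G"
    then show "R u v * (coef g a * coef h (component n m H v a' * component n m H u b) * coef k b') =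
        1 * (coef g a * (coef u b * coef v a' * coef h (x u * x v)) * coef k b')"
      using assms
      by (simp add: component_eq coef_scale coef_mult_x add_Znm_commute[of n m v u] braiding_of_def)
  qed
  then have "co3 (sweedler fscale T (\<lambda>a' b'. \<Sum>u\<in>G. \<Sum>v\<in>G.
        Poly_Mapping.single (a, component n m H v a' * component n m H u b, b') (R u v))) g h k
    = co3 (sweedler fscale T (\<lambda>a' b'. Poly_Mapping.single (a, b * a', b') 1)) g h k" for a b
    unfolding sweedler_def linear_comp_lin_ext[OF linear_co3] by (simp add: case_prod_beta')
  then show ?thesis
    unfolding co3_sweedler_middle[OF assms, symmetric] sweedler_def[of _ S]
      linear_comp_lin_ext[OF linear_co3] case_prod_beta' by (simp only:)
qed

lemma co_tensor_braided_mult: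
  assumes "g \<in> G" "h \<in> G"
  shows "co_tensor (braided_mult n m R scale H S T) g h =
    (\<Sum>p\<in>G. \<Sum>r\<in>G. co_tensor S p r * (\<Sum>s\<in>G. \<Sum>t\<in>G. co_tensor T s t *
       (R r s * (coef g (x p * x s) * coef h (x r * x t)))))"
proof -
  \<comment> \<open>Replacing components by coefficients makes the summand visibly bilinear in
    \<open>a\<close>, \<open>a'\<close> and in \<open>b\<close>, \<open>b'\<close>; on basis vectors
    only the term with \<open>R r s\<close> survives.\<close>
  let ?I = "\<lambda>a a' b b'. \<Sum>u\<in>G. \<Sum>v\<in>G. R u v * (coef v b * coef u a' * (coef g (a * x v) * coef h (x u * b')))"
  have summand: "co2 (\<Sum>u\<in>G. \<Sum>v\<in>G.
      Poly_Mapping.single (a * component n m H v b, component n m H u a' * b') (R u v)) g h = ?I a a' b b'"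
    for a a' b b'
    using assms by (simp add: co2_sum co2_single component_eq coef_scale mult_ac)
  have basis: "?I a (x r) (x s) b' = R r s * (coef g (a * x s) * coef h (x r * b'))"
    if "r \<in> G" "s \<in> G" for a r s b'
    using that by (simp add: coef_x mult_if_zero sum_if_const)
  have bilin_inner: "bilin (*) (\<lambda>b b'. ?I a a' b b')" for a a'
    using assms by (auto intro!: bilinI vector_space_mult
        simp: coef_add coef_scale algebra_simps sum.distrib sum_distrib_left)
  have inner: "co2 (sweedler fscale T (\<lambda>b b'. \<Sum>u\<in>G. \<Sum>v\<in>G.
      Poly_Mapping.single (a * component n m H v b, component n m H u a' * b') (R u v))) g h =
      (\<Sum>s\<in>G. \<Sum>t\<in>G. co_tensor T s t * ?I a a' (x s) (x t))" for a a'
    using bilin_inner by (subst co2_sweedler) (simp_all add: summand)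
  have "bilin (*) (\<lambda>a a'. \<Sum>s\<in>G. \<Sum>t\<in>G. co_tensor T s t * ?I a a' (x s) (x t))"
    using assms by (auto intro!: bilinI vector_space_mult
        simp: coef_add coef_scale algebra_simps sum.distrib sum_distrib_left)
  then show ?thesis
    unfolding braided_mult_def using assms
    by (subst co_tensor_tensor2, simp, simp, subst co2_sweedler) (simp_all add: inner basis)
qed

end

section \<open>The weak Hopf structures on a twisted group algebra\<close>

context twisted_group_algebra
begin

lemma co2_homogeneous:
  assumes "g \<in> G" "p \<in> G" "r \<in> G"
  shows "co2 (\<Sum>h\<in>G. Poly_Mapping.single (x h, x (g \<ominus> h)) (c h)) p r = (if p \<oplus> r = g then c p else 0)"
proof -
  have "co2 (\<Sum>h\<in>G. Poly_Mapping.single (x h, x (g \<ominus> h)) (c h)) p r =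
      (\<Sum>h\<in>G. if h = p then if p \<oplus> r = g then c p else 0 else 0)"
    unfolding co2_sum using assms
    by (intro sum.cong refl) (auto simp: co2_single coef_x add_eq_iff)
  then show ?thesis using assms by simp
qed

lemma scale_if_zero:
  "scale c (if P then a else 0) = (if P then scale c a else 0)"
  "scale (if P then c else 0) a = (if P then scale c a else 0)"
  by auto

lemma add_neg_eq_zero_iff: "g \<in> G \<Longrightarrow> h \<in> G \<Longrightarrow> g \<oplus> (\<zero> \<ominus> h) = \<zero> \<longleftrightarrow> h = g"
  by (metis add_Znm_commute add_diff diff_eqI n_pos zero_in_Znm)

text \<open>The cocycle identity, in which the factor \<open>F \<zero> k\<close> is
  \<open>1\<close>.\<close>

lemma F_inverse_cancel:
  assumes "g \<in> G" "h \<in> G" "k \<in> G" "g \<oplus> h = \<zero>"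
  shows "F h k * F g (h \<oplus> k) = F g h"
  using cocycle[of g h k] assms by simp

end

text \<open>The scalar \<open>l\<close> stands for \<open>\<epsilon> 1\<close>. Leaving it free lets
  the same computations serve existence, where \<open>l\<close> is \<open>n ^ m\<close>, and
  uniqueness, where this value is still to be derived.\<close>

locale twisted_coalgebra = twisted_group_algebra scale n m x F
  for scale :: "'k::field \<Rightarrow> 'a::ring_1 \<Rightarrow> 'a" and n m x F +
  fixes \<Delta> :: "'a \<Rightarrow> ('k, 'a) tensor2" and \<epsilon> :: "'a \<Rightarrow> 'k" and l :: 'k
  assumes l_nonzero [simp]: "l \<noteq> 0"
    and Delta_space [simp]: "\<And>a. \<Delta> a \<in> tensor2_space scale"
    and co_Delta: "\<And>g h a. g \<in> Znm n m \<Longrightarrow> h \<in> Znm n m \<Longrightarrow>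
      co_tensor (\<Delta> a) g h = coef (add_Znm n m g h) a / (l * F g h)"
    and eps_eq: "\<And>a. \<epsilon> a = l * coef (zero_Znm m) a"
begin

section \<open>The weak Hopf axioms for the comultiplication given by the inverse cocycle\<close>

lemma tensor_linear_Delta: "tensor_linear \<Delta>"
  by (auto simp: tensor_linear_def co_Delta coef_add coef_scale add_divide_distrib
      intro!: linearI vector_space_axioms vector_space_mult)

lemma linear_eps: "Vector_Spaces.linear scale (*) \<epsilon>"
  by (auto simp: eps_eq coef_add coef_scale algebra_simps
      intro!: linearI vector_space_axioms vector_space_mult)

lemmas eps_add = linear_addD[OF linear_eps] and eps_scale = linear_scaleD[OF linear_eps]

lemma eps_x: "g \<in> G \<Longrightarrow> \<epsilon> (x g) = (if g = \<zero> then l else 0)"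
  by (auto simp: eps_eq coef_x)

lemma eps_mult: "g \<in> G \<Longrightarrow> h \<in> G \<Longrightarrow> \<epsilon> (x g * x h) = (if g \<oplus> h = \<zero> then l * F g h else 0)"
  by (simp add: eps_eq coef_mult_x)

lemma sweedler_homogeneous:
  assumes "bilin s f" "g \<in> G"
  shows "sweedler s (\<Delta> (scale c (x g))) f =
    (\<Sum>h\<in>G. s (c / (l * F h (g \<ominus> h))) (f (x h) (x (g \<ominus> h))))"
proof -
  interpret s: vector_space s
    using assms unfolding bilin_def by (blast dest: linear_vs2)
  have "sweedler s (\<Delta> (scale c (x g))) f =
      (\<Sum>h\<in>G. \<Sum>k\<in>G. if h \<oplus> k = g then s (c / (l * F h k)) (f (x h) (x k)) else 0)"
    unfolding sweedler_bilin[OF assms(1)] using assms(2)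
    by (intro sum.cong refl) (auto simp: co_Delta coef_scale coef_x)
  then show ?thesis using assms(2) by (simp add: sum_add_eq)
qed

lemma sweedler_one:
  assumes "bilin s f"
  shows "sweedler s (\<Delta> 1) f = (\<Sum>h\<in>G. s (1 / (l * F h (\<zero> \<ominus> h))) (f (x h) (x (\<zero> \<ominus> h))))"
  using sweedler_homogeneous[OF assms, of \<zero> 1] by (simp add: x_zero)

text \<open>The counit keeps only degree zero, where \<open>F\<close> is normalised, and its factor
  \<open>l\<close> cancels the \<open>l\<close> in the denominator of
  \<open>\<Delta>\<close>.\<close>

lemma counit:
  "sweedler scale (\<Delta> a) (\<lambda>a b. scale (\<epsilon> a) b) = a" "sweedler scale (\<Delta> a) (\<lambda>a b. scale (\<epsilon> b) a) = a"
proof -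
  have "bilin scale (\<lambda>a b. scale (\<epsilon> a) b)" "bilin scale (\<lambda>a b. scale (\<epsilon> b) a)"
    by (auto intro!: bilinI vector_space_axioms simp: eps_add eps_scale algebra_simps)
  note * = this[THEN sweedler_bilin]
  show "sweedler scale (\<Delta> a) (\<lambda>a b. scale (\<epsilon> a) b) = a"
    by (rule trans[OF _ sum_coef])
       (simp add: * co_Delta eps_x mult_if_zero scale_if_zero sum_if_const)
  show "sweedler scale (\<Delta> a) (\<lambda>a b. scale (\<epsilon> b) a) = a"
    by (rule trans[OF _ sum_coef])
       (simp add: * co_Delta eps_x mult_if_zero scale_if_zero sum_if_const)
qed

text \<open>The denominators here and in \<open>co3_Delta_right\<close> contain the two sides of the
  cocycle identity, which therefore yields coassociativity.\<close>

lemma co3_Delta_left: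
  assumes "g \<in> G" "h \<in> G" "k \<in> G"
  shows "co3 (sweedler fscale (\<Delta> a) (\<lambda>a b. sweedler fscale (\<Delta> a) (\<lambda>a1 a2.
      Poly_Mapping.single (a1, a2, b) 1))) g h k =
    coef (g \<oplus> h \<oplus> k) a / (l * l * (F g h * F (g \<oplus> h) k))"
  using assms
  by (simp add: co3_sweedler_left[OF tensor_linear_Delta] co_Delta coef_x mult_if_zero
      if_distrib[of "\<lambda>y. y / _"] mult_ac cong: if_cong)

lemma co3_Delta_right:
  assumes "g \<in> G" "h \<in> G" "k \<in> G"
  shows "co3 (sweedler fscale (\<Delta> a) (\<lambda>a b. sweedler fscale (\<Delta> b) (\<lambda>b1 b2.
      Poly_Mapping.single (a, b1, b2) 1))) g h k =
    coef (g \<oplus> h \<oplus> k) a / (l * l * (F h k * F g (h \<oplus> k)))"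
  using assms
  by (simp add: co3_sweedler_right[OF tensor_linear_Delta] co_Delta coef_x mult_if_zero
      if_distrib[of "\<lambda>y. y / _"] mult_ac add_Znm_assoc cong: if_cong)

text \<open>In the first copy of \<open>\<Delta> 1\<close> the degree \<open>v\<close> must be
  inverse to \<open>g\<close>, in the second \<open>u\<close> must be inverse to \<open>k\<close>;
  their product has degree \<open>h\<close> exactly when \<open>g \<oplus> h \<oplus> k\<close> is
  zero.\<close>

lemma co3_Delta_middle:
  assumes "g \<in> G" "h \<in> G" "k \<in> G"
  shows "(\<Sum>v\<in>G. \<Sum>u\<in>G. co_tensor (\<Delta> 1) g v * (co_tensor (\<Delta> 1) u k * coef h (x v * x u))) =
    coef (g \<oplus> h \<oplus> k) 1 / (l * l * (F g h * F (g \<oplus> h) k))"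
proof -
  let ?v = "\<zero> \<ominus> g" and ?u = "\<zero> \<ominus> k"
  have gv: "g \<oplus> ?v = \<zero>" and uk: "?u \<oplus> k = \<zero>"
    using assms by simp_all
  have "(\<Sum>v\<in>G. \<Sum>u\<in>G. co_tensor (\<Delta> 1) g v * (co_tensor (\<Delta> 1) u k * coef h (x v * x u))) =
    (\<Sum>v\<in>G. if g \<oplus> v = \<zero> then \<Sum>u\<in>G. if k \<oplus> u = \<zero> then
        coef h (x v * x u) / (l * F g v * (l * F u k)) else 0 else 0)"
    using assms by (intro sum.cong refl) (auto simp: co_Delta coef_one add_Znm_commute[of n m k] intro!: sum.cong)
  also have "\<dots> = (if ?v \<oplus> ?u = h then F ?v ?u else 0) / (l * F g ?v * (l * F ?u k))"
    using assms by (simp add: sum_add_eq coef_mult_x)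
  also have "\<dots> = coef (g \<oplus> h \<oplus> k) 1 / (l * l * (F g h * F (g \<oplus> h) k))"
  proof (cases "?v \<oplus> ?u = h")
    case True
    have gh: "g \<oplus> h = ?u"
      using gv True assms by (metis add_Znm_assoc add_zero_Znm diff_in_Znm n_pos)
    have "F ?v ?u * F g h = F g ?v"
      using F_inverse_cancel[of g ?v ?u] gv True assms by simp
    then show ?thesis
      using True gh uk assms by (simp add: coef_one field_simps)
  next
    case False
    have "g \<oplus> h \<oplus> k \<noteq> \<zero>"
    proof
      assume "g \<oplus> h \<oplus> k = \<zero>"
      then have 1: "g \<oplus> k \<oplus> h = \<zero>"
        by (simp only: add_Znm_ac)
      have "g \<oplus> k \<oplus> (?v \<oplus> ?u) = (g \<oplus> ?v) \<oplus> (?u \<oplus> k)"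
        by (simp only: add_Znm_ac)
      then have 2: "g \<oplus> k \<oplus> (?v \<oplus> ?u) = \<zero>"
        by (simp add: gv uk)
      show False
        using False diff_eqI[OF 1] diff_eqI[OF 2] assms by simp
    qed
    with False assms show ?thesis by (simp add: coef_one)
  qed
  finally show ?thesis .
qed

lemma bilin_eps: "bilin (*) (\<lambda>g1 g2. \<epsilon> (f * g1) * \<epsilon> (g2 * h))"
  by (auto intro!: bilinI vector_space_mult simp: eps_add eps_scale algebra_simps)

text \<open>The first counit factor selects the term whose left leg has degree inverse to
  \<open>a\<close>, so the right leg has degree \<open>a \<oplus> b\<close>. Then
  \<open>F_inverse_cancel\<close> produces the factor \<open>F a b\<close> of
  \<open>x a * x b\<close>.\<close>

lemma eps_multiplicative:
  assumes "a \<in> G" "b \<in> G" "k \<in> G"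
  shows "sweedler (*) (\<Delta> (scale d (x b))) (\<lambda>g1 g2. \<epsilon> (scale c (x a) * g1) * \<epsilon> (g2 * scale e (x k))) =
    \<epsilon> (scale c (x a) * scale d (x b) * scale e (x k))"
proof -
  let ?h = "\<zero> \<ominus> a"
  have ah: "a \<oplus> ?h = \<zero>" using assms by simp
  have diff: "b \<ominus> ?h = a \<oplus> b"
    using assms ah by (intro diff_eqI) (auto simp: add_Znm_assoc[symmetric] add_Znm_commute[of n m ?h])
  have "sweedler (*) (\<Delta> (scale d (x b))) (\<lambda>g1 g2. \<epsilon> (scale c (x a) * g1) * \<epsilon> (g2 * scale e (x k))) =
    (\<Sum>h\<in>G. if a \<oplus> h = \<zero> then d / (l * F h (b \<ominus> h)) * (c * (l * F a h) * (e * \<epsilon> (x (b \<ominus> h) * x k))) else 0)"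
    unfolding sweedler_homogeneous[OF bilin_eps assms(2)] using assms(1)
    by (intro sum.cong refl) (simp add: eps_scale eps_mult[of a])
  also have "\<dots> = d / (l * F ?h (a \<oplus> b)) * (c * (l * F a ?h) * (e * \<epsilon> (x (a \<oplus> b) * x k)))"
    using assms by (simp add: sum_add_eq diff)
  also have "\<dots> = \<epsilon> (scale c (x a) * scale d (x b) * scale e (x k))"
  proof -
    have "?h \<oplus> (a \<oplus> b) = b"
      using ah assms by (simp add: add_Znm_assoc[symmetric] add_Znm_commute[of n m ?h])
    then have "F ?h (a \<oplus> b) * F a b = F a ?h"
      using F_inverse_cancel[of a ?h "a \<oplus> b"] assms ah by simp
    then have F: "F a b = F a ?h / F ?h (a \<oplus> b)"
      using assms by (simp add: field_simps)
    show ?thesis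
      using assms by (simp add: eps_scale x_mult[of a b]) (simp add: F)
  qed
  finally show ?thesis .
qed

text \<open>Replacing \<open>h\<close> by \<open>b \<ominus> h\<close> exchanges the two legs, and
  \<open>R h (b \<ominus> h)\<close> turns the denominator \<open>F h (b \<ominus> h)\<close> into
  \<open>F (b \<ominus> h) h\<close>. The braided sum is therefore the reflected unbraided
  one.\<close>

lemma eps_multiplicative_braided:
  assumes "a \<in> G" "b \<in> G" "k \<in> G"
  shows "sweedler (*) (\<Delta> (scale d (x b))) (\<lambda>g1 g2. \<Sum>u\<in>G. \<Sum>v\<in>G. R u v *
      (\<epsilon> (scale c (x a) * component n m H v g2) * \<epsilon> (component n m H u g1 * scale e (x k)))) =
    \<epsilon> (scale c (x a) * scale d (x b) * scale e (x k))"
proof -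
  let ?f = "\<lambda>g1 g2. \<epsilon> (scale c (x a) * g1) * \<epsilon> (g2 * scale e (x k))"
  let ?B = "\<lambda>g1 g2. \<Sum>u\<in>G. \<Sum>v\<in>G. coef u g1 * coef v g2 * (R u v * ?f (x v) (x u))"
  have eq: "(\<lambda>g1 g2. \<Sum>u\<in>G. \<Sum>v\<in>G. R u v *
      (\<epsilon> (scale c (x a) * component n m H v g2) * \<epsilon> (component n m H u g1 * scale e (x k)))) = ?B"
    by (intro ext sum.cong refl) (simp add: component_eq eps_scale mult_ac)
  have "bilin (*) ?B"
    by (auto intro!: bilinI vector_space_mult
        simp: coef_add coef_scale algebra_simps sum.distrib sum_distrib_left)
  from sweedler_homogeneous[OF this assms(2), of d]
  have "sweedler (*) (\<Delta> (scale d (x b))) ?B =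
      (\<Sum>h\<in>G. d / (l * F h (b \<ominus> h)) * ?B (x h) (x (b \<ominus> h)))" .
  also have "\<dots> = (\<Sum>h\<in>G. d / (l * F (b \<ominus> h) h) * ?f (x (b \<ominus> h)) (x h))"
  proof (intro sum.cong refl)
    fix h assume h: "h \<in> G"
    have "?B (x h) (x (b \<ominus> h)) = R h (b \<ominus> h) * ?f (x (b \<ominus> h)) (x h)"
      using h by (simp add: coef_x mult_if_zero sum_if_const)
    then show "d / (l * F h (b \<ominus> h)) * ?B (x h) (x (b \<ominus> h)) = d / (l * F (b \<ominus> h) h) * ?f (x (b \<ominus> h)) (x h)"
      using h by (simp add: braiding_of_def)
  qed
  also have "\<dots> = (\<Sum>h\<in>G. d / (l * F h (b \<ominus> h)) * ?f (x h) (x (b \<ominus> h)))"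
    using sum_reflect[OF assms(2), of "\<lambda>h. d / (l * F h (b \<ominus> h)) * ?f (x h) (x (b \<ominus> h))"] assms(2)
    by simp
  also have "\<dots> = sweedler (*) (\<Delta> (scale d (x b))) ?f"
    by (rule sweedler_homogeneous[OF bilin_eps assms(2), symmetric])
  finally show ?thesis
    unfolding eq using eps_multiplicative[OF assms] by simp
qed

text \<open>By \<open>four_factors\<close> each summand depends on \<open>p\<close> and
  \<open>r\<close> only through \<open>p \<oplus> r\<close>, and the sum over that degree is the
  coefficient formula for \<open>a * b\<close>. The other summation contributes
  \<open>n ^ m\<close>, so multiplicativity holds up to the scalar \<open>n ^ m / l\<close>.\<close>

lemma co_tensor_braided_mult_Delta:
  assumes "g \<in> G" "h \<in> G"
  shows "co_tensor (braided_mult n m R scale H (\<Delta> a) (\<Delta> b)) g h =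
    of_nat (n ^ m) / l * co_tensor (\<Delta> (a * b)) g h"
proof -
  let ?Q = "\<lambda>u. coef u a * coef (g \<oplus> h \<ominus> u) b * F u (g \<oplus> h \<ominus> u)"
  have summand: "co_tensor (\<Delta> a) p r * (\<Sum>s\<in>G. \<Sum>t\<in>G. co_tensor (\<Delta> b) s t *
       (R r s * (coef g (x p * x s) * coef h (x r * x t)))) = ?Q (p \<oplus> r) / (l * (l * F g h))"
    if "p \<in> G" "r \<in> G" for p r
  proof -
    \<comment> \<open>The degrees of the second tensor are forced by \<open>p \<oplus> s = g\<close>
      and \<open>r \<oplus> t = h\<close>.\<close>
    let ?s = "g \<ominus> p" and ?t = "h \<ominus> r"
    have "p \<oplus> r \<oplus> (?s \<oplus> ?t) = (p \<oplus> ?s) \<oplus> (r \<oplus> ?t)"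
      by (simp only: add_Znm_ac)
    then have st: "g \<oplus> h \<ominus> (p \<oplus> r) = ?s \<oplus> ?t"
      using assms by (intro diff_eqI) simp_all
    have "(\<Sum>s\<in>G. \<Sum>t\<in>G. co_tensor (\<Delta> b) s t * (R r s * (coef g (x p * x s) * coef h (x r * x t)))) =
      (\<Sum>s\<in>G. if p \<oplus> s = g then \<Sum>t\<in>G. if r \<oplus> t = h then
         co_tensor (\<Delta> b) s t * (R r s * (F p s * F r t)) else 0 else 0)"
      using assms that by (intro sum.cong refl) (auto simp: coef_mult_x intro!: sum.cong)
    also have "\<dots> = coef (?s \<oplus> ?t) b / (l * F ?s ?t) * (R r ?s * (F p ?s * F r ?t))"
      using assms that by (simp add: sum_add_eq co_Delta)
    finally have "co_tensor (\<Delta> a) p r * (\<Sum>s\<in>G. \<Sum>t\<in>G. co_tensor (\<Delta> b) s t *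
       (R r s * (coef g (x p * x s) * coef h (x r * x t)))) =
       coef (p \<oplus> r) a / (l * F p r) * (coef (?s \<oplus> ?t) b / (l * F ?s ?t) * (R r ?s * (F p ?s * F r ?t)))"
      using that by (simp add: co_Delta)
    also have "R r ?s * (F p ?s * F r ?t) = F p r * F ?s ?t * F (p \<oplus> r) (?s \<oplus> ?t) / F g h"
      using four_factors[of p r ?s ?t] assms that by (simp add: field_simps)
    finally show ?thesis
      using that by (simp add: st)
  qed
  have "co_tensor (braided_mult n m R scale H (\<Delta> a) (\<Delta> b)) g h =
      (\<Sum>p\<in>G. \<Sum>r\<in>G. ?Q (p \<oplus> r) / (l * (l * F g h)))"
    unfolding co_tensor_braided_mult[OF assms] by (intro sum.cong refl summand)
  also have "\<dots> = (\<Sum>p\<in>G. \<Sum>u\<in>G. ?Q u / (l * (l * F g h)))"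
    by (intro sum.cong refl sum_translate)
  also have "\<dots> = of_nat (n ^ m) / l * co_tensor (\<Delta> (a * b)) g h"
    using assms by (simp add: card_Znm co_Delta coef_mult sum_divide_distrib[symmetric] field_simps)
  finally show ?thesis .
qed

text \<open>The counit forces the left leg of \<open>\<Delta> 1\<close> to have degree inverse to
  \<open>g\<close>, so the right leg has degree \<open>g\<close>; there \<open>R g g\<close> is
  \<open>1\<close> and the factors \<open>F\<close> cancel. The target counital map is the identity
  on homogeneous elements.\<close>

lemma target_counital:
  assumes "g \<in> G"
  shows "sweedler scale (\<Delta> 1) (\<lambda>a b. \<Sum>u\<in>G.
    scale (R u g * \<epsilon> (a * scale c (x g))) (component n m H u b)) = scale c (x g)"
proof -
  let ?B = "\<lambda>a b. \<Sum>u\<in>G. scale (R u g * \<epsilon> (a * scale c (x g)) * coef u b) (x u)"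
  have eq: "(\<lambda>a b. \<Sum>u\<in>G. scale (R u g * \<epsilon> (a * scale c (x g))) (component n m H u b)) = ?B"
    by (intro ext sum.cong refl) (simp add: component_eq)
  have B: "bilin scale ?B"
    by (auto intro!: bilinI vector_space_axioms simp: eps_add eps_scale coef_add coef_scale
        algebra_simps sum.distrib scale_sum_right)
  have "?B (x h) (x k) = scale (R k g * (c * \<epsilon> (x h * x g))) (x k)" if "h \<in> G" "k \<in> G" for h k
    using that by (simp add: coef_x eps_scale mult_if_zero scale_if_zero)
  then have "sweedler scale (\<Delta> 1) ?B = (\<Sum>h\<in>G. if g \<oplus> h = \<zero> then
      scale (1 / (l * F h (\<zero> \<ominus> h))) (scale (R (\<zero> \<ominus> h) g * (c * (l * F h g))) (x (\<zero> \<ominus> h))) else 0)"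
    unfolding sweedler_one[OF B] using assms
    by (intro sum.cong refl) (auto simp: eps_mult add_Znm_commute[of n m g])
  also have "\<dots> = scale c (x g)"
    using assms by (simp add: sum_add_eq)
  finally show ?thesis unfolding eq .
qed

lemma source_counital:
  assumes "g \<in> G"
  shows "sweedler scale (\<Delta> 1) (\<lambda>a b. \<Sum>u\<in>G.
    scale (R g u * \<epsilon> (scale c (x g) * b)) (component n m H u a)) = scale c (x g)"
proof -
  let ?B = "\<lambda>a b. \<Sum>u\<in>G. scale (R g u * \<epsilon> (scale c (x g) * b) * coef u a) (x u)"
  have eq: "(\<lambda>a b. \<Sum>u\<in>G. scale (R g u * \<epsilon> (scale c (x g) * b)) (component n m H u a)) = ?B"
    by (intro ext sum.cong refl) (simp add: component_eq)
  have B: "bilin scale ?B"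
    by (auto intro!: bilinI vector_space_axioms simp: eps_add eps_scale coef_add coef_scale
        algebra_simps sum.distrib scale_sum_right)
  have "?B (x h) (x k) = scale (R g h * (c * \<epsilon> (x g * x k))) (x h)" if "h \<in> G" "k \<in> G" for h k
    using that by (simp add: coef_x eps_scale mult_if_zero scale_if_zero)
  then have "sweedler scale (\<Delta> 1) ?B = (\<Sum>h\<in>G. if h = g then
      scale (1 / (l * F h (\<zero> \<ominus> h))) (scale (R g h * (c * (l * F g (\<zero> \<ominus> h)))) (x h)) else 0)"
    unfolding sweedler_one[OF B] using assms
    by (intro sum.cong refl) (auto simp: eps_mult add_neg_eq_zero_iff)
  also have "\<dots> = scale c (x g)"
    using assms by simp
  finally show ?thesis unfolding eq .
qed

text \<open>Multiplying the two legs restores the factor \<open>F h (g \<ominus> h)\<close> that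
  \<open>\<Delta>\<close> divides by, so every summand is a multiple of \<open>x g\<close>.\<close>

lemma sweedler_diagonal:
  assumes "g \<in> G" "bilin scale f"
    and "\<And>h k. h \<in> G \<Longrightarrow> k \<in> G \<Longrightarrow> f (x h) (x k) = scale (t h k) (x h * x k)"
  shows "sweedler scale (\<Delta> (scale c (x g))) f = scale ((\<Sum>h\<in>G. t h (g \<ominus> h)) / l) (scale c (x g))"
  unfolding sweedler_homogeneous[OF assms(2,1)] using assms(1)
  by (simp add: assms(3) x_mult scale_sum_left[symmetric] sum_divide_distrib sum_distrib_left mult_ac)

text \<open>For a diagonal map the convolutions depend on the eigenvalues only through their sum.
  Since both counital maps are the identity, the first two antipode conditions amount to
  \<open>sum s G = l\<close>.\<close>

lemma antipode_convolution:
  assumes S: "Vector_Spaces.linear scale scale S" "\<And>g. g \<in> G \<Longrightarrow> S (x g) = scale (s g) (x g)"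
    and g: "g \<in> G"
  shows "sweedler scale (\<Delta> (scale c (x g))) (\<lambda>h1 h2. h1 * S h2) = scale (sum s G / l) (scale c (x g))"
    and "sweedler scale (\<Delta> (scale c (x g))) (\<lambda>h1 h2. S h1 * h2) = scale (sum s G / l) (scale c (x g))"
proof -
  have B: "bilin scale (\<lambda>h1 h2. h1 * S h2)" "bilin scale (\<lambda>h1 h2. S h1 * h2)"
    by (auto intro!: bilinI vector_space_axioms
        simp: linear_addD[OF S(1)] linear_scaleD[OF S(1)] algebra_simps)
  show "sweedler scale (\<Delta> (scale c (x g))) (\<lambda>h1 h2. h1 * S h2) = scale (sum s G / l) (scale c (x g))"
    using sweedler_diagonal[OF g B(1), of "\<lambda>h k. s k" c] sum_reflect[OF g, of s] by (simp add: S(2))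
  show "sweedler scale (\<Delta> (scale c (x g))) (\<lambda>h1 h2. S h1 * h2) = scale (sum s G / l) (scale c (x g))"
    using sweedler_diagonal[OF g B(2), of "\<lambda>h k. s h" c] by (simp add: S(2))
qed

text \<open>If the sum is \<open>l\<close>, convolving \<open>S\<close> with the identity gives the
  identity, so the triple product reduces to \<open>h1 * S h2\<close>, again the identity. The third
  antipode condition thereby becomes \<open>S h = h\<close>.\<close>

lemma antipode_sum:
  assumes S: "Vector_Spaces.linear scale scale S" "\<And>g. g \<in> G \<Longrightarrow> S (x g) = scale (s g) (x g)"
    and s: "sum s G = l" and g: "g \<in> G"
  shows "sweedler scale (\<Delta> (scale c (x g))) (\<lambda>a h3. sweedler scale (\<Delta> a) (\<lambda>h1 h2. (S h1 * h2) * S h3)) =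
    scale c (x g)"
proof -
  let ?f = "\<lambda>a h3. sweedler scale (\<Delta> a) (\<lambda>h1 h2. (S h1 * h2) * S h3)"
  have f: "?f a b = a * S b" for a b
  proof -
    have B: "bilin scale (\<lambda>h1 h2. S h1 * h2)" "bilin scale (\<lambda>h1 h2. (S h1 * h2) * S b)"
      by (auto intro!: bilinI vector_space_axioms
          simp: linear_addD[OF S(1)] linear_scaleD[OF S(1)] algebra_simps)
    have "?f a b = sweedler scale (\<Delta> a) (\<lambda>h1 h2. S h1 * h2) * S b"
      unfolding B[THEN sweedler_bilin] by (simp add: sum_distrib_right)
    moreover have "sweedler scale (\<Delta> a) (\<lambda>h1 h2. S h1 * h2) = a"
    proof -
      have lin: "Vector_Spaces.linear scale scale (\<lambda>a. sweedler scale (\<Delta> a) (\<lambda>h1 h2. S h1 * h2))"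
        unfolding B[THEN sweedler_bilin]
        by (auto intro!: linearI vector_space_axioms simp: co_Delta coef_add coef_scale
            add_divide_distrib scale_left_distrib sum.distrib scale_sum_right)
      have "sweedler scale (\<Delta> (x g)) (\<lambda>h1 h2. S h1 * h2) = x g" if "g \<in> G" for g
        using antipode_convolution(2)[OF S that, of 1] s by simp
      then show ?thesis
        using linear_expand[OF lin, of a] sum_coef[of a] by simp
    qed
    ultimately show ?thesis by simp
  qed
  show ?thesis
    using antipode_convolution(1)[OF S g, of c] s by (simp add: f)
qed

text \<open>The value of \<open>l\<close> enters twice: it turns the scalar in
  \<open>co_tensor_braided_mult_Delta\<close> into \<open>1\<close>, and it is the sum of the
  eigenvalues \<open>1\<close> of the identity map over all \<open>n ^ m\<close> degrees.\<close>

theorem weak_hopf_algebra: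
  assumes "l = of_nat (n ^ m)"
  shows "weak_hopf_algebra n m R scale H \<Delta> \<epsilon> (\<lambda>a. a)"
proof -
  have id: "Vector_Spaces.linear scale scale (\<lambda>a. a)" "\<And>g. g \<in> G \<Longrightarrow> x g = scale 1 (x g)"
    by (auto intro!: linearI vector_space_axioms)
  have sum1: "(\<Sum>g\<in>G. 1) = l"
    by (simp add: card_Znm assms)
  have normalized: "of_nat (n ^ m) / l = 1"
    unfolding assms[symmetric] by simp
  have degree: "\<exists>s\<in>\<Delta> a. Poly_Mapping.keys s \<subseteq>
      (\<Union>(u, v)\<in>{(u, v). u \<in> G \<and> v \<in> G \<and> u \<oplus> v = g}. H u \<times> H v)"
    if g: "g \<in> G" and "a \<in> H g" for g a
  proof -
    obtain c where a: "a = scale c (x g)"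
      using \<open>a \<in> H g\<close> by (auto simp: H_iff)
    \<comment> \<open>Degree preservation asks for a representative supported on homogeneous pairs,
      so one with monomial legs is written down.\<close>
    let ?s = "\<Sum>h\<in>G. Poly_Mapping.single (x h, x (g \<ominus> h)) (c / (l * F h (g \<ominus> h)))"
    have "?s \<in> \<Delta> a"
      using g by (auto simp: mem_tensor2_space_iff co2_homogeneous co_Delta a coef_scale coef_x)
    moreover have "Poly_Mapping.keys ?s \<subseteq> (\<Union>h\<in>G. {(x h, x (g \<ominus> h))})"
      by (rule order_trans[OF Poly_Mapping.keys_sum]) auto
    moreover have "(\<Union>h\<in>G. {(x h, x (g \<ominus> h))}) \<subseteq>
        (\<Union>(u, v)\<in>{(u, v). u \<in> G \<and> v \<in> G \<and> u \<oplus> v = g}. H u \<times> H v)"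
    proof
      fix p assume "p \<in> (\<Union>h\<in>G. {(x h, x (g \<ominus> h))})"
      then obtain h where "h \<in> G" "p = (x h, x (g \<ominus> h))" by blast
      moreover have "x h \<in> H h" for h
        unfolding H_iff by (rule exI[of _ 1]) simp
      ultimately show "p \<in> (\<Union>(u, v)\<in>{(u, v). u \<in> G \<and> v \<in> G \<and> u \<oplus> v = g}. H u \<times> H v)"
        using g by (intro UN_I[of "(h, g \<ominus> h)"]) auto
    qed
    ultimately show ?thesis by blast
  qed
  have coalgebra: "graded_coalgebra n m scale H \<Delta> \<epsilon>"
    unfolding graded_coalgebra_def
  proof (intro conjI)
    show "\<forall>g\<in>G. g \<noteq> \<zero> \<longrightarrow> (\<forall>x\<in>H g. \<epsilon> x = 0)"
      by (auto simp: H_iff eps_scale eps_x)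
    show "\<forall>a. tensor3 scale (sweedler fscale (\<Delta> a) (\<lambda>a b. sweedler fscale (\<Delta> a) (\<lambda>a1 a2.
              Poly_Mapping.single (a1, a2, b) 1))) =
          tensor3 scale (sweedler fscale (\<Delta> a) (\<lambda>a b. sweedler fscale (\<Delta> b) (\<lambda>b1 b2.
              Poly_Mapping.single (a, b1, b2) 1)))"
      unfolding tensor3_eq_iff by (simp add: co3_Delta_left co3_Delta_right cocycle)
  qed (use tensor_linear_Delta graded_space linear_eps degree counit in \<open>simp_all add: tensor_linear_iff\<close>)
  show ?thesis
    unfolding weak_hopf_algebra_def
  proof (intro conjI allI ballI)
    show "\<Delta> (a * b) = braided_mult n m R scale H (\<Delta> a) (\<Delta> b)" for a b
    proof (rule tensor2_space_eqI)
      show "braided_mult n m R scale H (\<Delta> a) (\<Delta> b) \<in> tensor2_space scale"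
        by (simp add: braided_mult_def)
    qed (simp_all only: co_tensor_braided_mult_Delta normalized Delta_space mult_1_left)
  next
    fix df dg dh f g h assume "df \<in> G" "dg \<in> G" "dh \<in> G" "f \<in> H df" "g \<in> H dg" "h \<in> H dh"
    then show "\<epsilon> (f * g * h) = sweedler (*) (\<Delta> g) (\<lambda>g1 g2. \<epsilon> (f * g1) * \<epsilon> (g2 * h))"
      "\<epsilon> (f * g * h) = sweedler (*) (\<Delta> g) (\<lambda>g1 g2. \<Sum>u\<in>G. \<Sum>v\<in>G.
          R u v * (\<epsilon> (f * component n m H v g2) * \<epsilon> (component n m H u g1 * h)))"
      unfolding H_iff using eps_multiplicative eps_multiplicative_braided by auto
  next
    fix g h assume "g \<in> G" "h \<in> H g"
    then show
      "sweedler scale (\<Delta> h) (\<lambda>h1 h2. h1 * h2) =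
          sweedler scale (\<Delta> 1) (\<lambda>a b. \<Sum>u\<in>G. scale (R u g * \<epsilon> (a * h)) (component n m H u b))"
      "sweedler scale (\<Delta> h) (\<lambda>h1 h2. h1 * h2) =
          sweedler scale (\<Delta> 1) (\<lambda>a b. \<Sum>u\<in>G. scale (R g u * \<epsilon> (h * b)) (component n m H u a))"
      "h = sweedler scale (\<Delta> h) (\<lambda>a h3. sweedler scale (\<Delta> a) (\<lambda>h1 h2. (h1 * h2) * h3))"
      unfolding H_iff
      using antipode_convolution(1)[OF id] antipode_sum[OF id sum1] target_counital source_counital sum1
      by auto
  qed (use graded_algebra coalgebra id in \<open>simp_all add: tensor3_eq_iff co3_Delta_left co3_sweedler_middle
        co3_sweedler_middle_braided co3_Delta_middle\<close>)
qed

end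

section \<open>Existence and uniqueness of the weak Hopf structure on a twisted group
  algebra\<close>

context twisted_group_algebra
begin

text \<open>Summing over all pairs of degrees with \<open>coef (h \<oplus> k) a\<close> treats
  inhomogeneous \<open>a\<close> at once and makes linearity in \<open>a\<close> immediate.\<close>

definition Delta :: "'a \<Rightarrow> ('k, 'a) tensor2" where
  "Delta a = tensor2 scale (\<Sum>h\<in>G. \<Sum>k\<in>G.
     Poly_Mapping.single (x h, x k) (coef (h \<oplus> k) a / (of_nat (n ^ m) * F h k)))"

lemma twisted_coalgebra_Delta:
  assumes "of_nat (n ^ m) \<noteq> (0 :: 'k)"
  shows "twisted_coalgebra scale n m x F Delta (\<lambda>a. of_nat (n ^ m) * coef \<zero> a) (of_nat (n ^ m))"
proof (unfold_locales)
  fix g h a assume gh: "g \<in> G" "h \<in> G"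
  then have "co_tensor (Delta a) g h = (\<Sum>u\<in>G. if u = g then \<Sum>v\<in>G. if v = h then
      coef (u \<oplus> v) a / (of_nat (n ^ m) * F u v) else 0 else 0)"
    unfolding Delta_def co_tensor_tensor2[OF gh] co2_sum
    by (intro sum.cong refl) (auto simp: co2_single coef_x mult_if_zero if_distrib[of "\<lambda>y. y / _"] cong: if_cong)
  with gh show "co_tensor (Delta a) g h = coef (g \<oplus> h) a / (of_nat (n ^ m) * F g h)"
    by simp
qed (use assms in \<open>simp_all add: Delta_def\<close>)

text \<open>Testing the weak multiplicativity of \<open>\<epsilon>\<close> on \<open>x (- g)\<close>, \<open>x b\<close>, \<open>x (- h)\<close> isolates the coefficient
  of \<open>x g \<otimes> x h\<close> in \<open>\<Delta> (x b)\<close>.\<close>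

lemma weak_hopf_twisted_coalgebra:
  assumes W: "weak_hopf_algebra n m R scale H \<Delta> \<epsilon> S"
  shows "twisted_coalgebra scale n m x F \<Delta> \<epsilon> (\<epsilon> 1)"
proof -
  have C: "graded_coalgebra n m scale H \<Delta> \<epsilon>"
    using W by (simp add: weak_hopf_algebra_def)
  then have lin: "tensor_linear \<Delta>"
    unfolding graded_coalgebra_def tensor_linear_iff by blast
  have eps: "Vector_Spaces.linear scale (*) \<epsilon>"
    using C unfolding graded_coalgebra_def by blast
  have xH: "x g \<in> H g" for g
    unfolding H_iff by (rule exI[of _ 1]) simp
  have eps_x: "\<epsilon> (x g) = (if g = \<zero> then \<epsilon> 1 else 0)" if "g \<in> G" for g
    using C that xH x_zero unfolding graded_coalgebra_def by auto
  have eps_eq: "\<epsilon> a = \<epsilon> 1 * coef \<zero> a" for a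
  proof -
    have "\<epsilon> a = (\<Sum>g\<in>G. if g = \<zero> then \<epsilon> 1 * coef \<zero> a else 0)"
      by (subst linear_expand[OF eps], intro sum.cong refl) (simp add: eps_x mult.commute)
    then show ?thesis by simp
  qed
  \<comment> \<open>Otherwise \<open>\<epsilon>\<close> vanishes identically and the counit law at
    \<open>1\<close> gives \<open>1 = 0\<close>, against \<open>coef_one\<close>.\<close>
  have nonzero: "\<epsilon> 1 \<noteq> 0"
  proof
    assume "\<epsilon> 1 = 0"
    then have "\<epsilon> a = 0" for a
      using eps_eq[of a] by simp
    moreover have "sweedler scale (\<Delta> 1) (\<lambda>a b. scale (\<epsilon> a) b) = 1"
      using C unfolding graded_coalgebra_def by blast
    ultimately have "(1 :: 'a) = 0"
      by (simp add: sweedler_def lin_ext_def case_prod_beta)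
    then show False
      using coef_one[of \<zero>] coef_add[of \<zero> 0 0] by simp
  qed
  have bilin_eps: "bilin (*) (\<lambda>g1 g2. \<epsilon> (f * g1) * \<epsilon> (g2 * h))" for f h
    by (auto intro!: bilinI vector_space_mult
        simp: linear_addD[OF eps] linear_scaleD[OF eps] algebra_simps)
  have eps_mult: "\<epsilon> (x g * x h) = (if g \<oplus> h = \<zero> then \<epsilon> 1 * F g h else 0)"
    if "g \<in> G" "h \<in> G" for g h
    using that by (simp add: eps_eq[of "x g * x h"] coef_mult_x)
  have weak_multiplicative: "\<forall>df\<in>G. \<forall>dg\<in>G. \<forall>dh\<in>G. \<forall>f\<in>H df. \<forall>g\<in>H dg. \<forall>h\<in>H dh.
      \<epsilon> (f * g * h) = sweedler (*) (\<Delta> g) (\<lambda>g1 g2. \<epsilon> (f * g1) * \<epsilon> (g2 * h))"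
    using W unfolding weak_hopf_algebra_def by blast
  have co_x: "co_tensor (\<Delta> (x b)) g h = (if g \<oplus> h = b then 1 / (\<epsilon> 1 * F g h) else 0)"
    if gh: "g \<in> G" "h \<in> G" and b: "b \<in> G" for g h b
  proof -
    let ?a = "\<zero> \<ominus> g" and ?c = "\<zero> \<ominus> h"
    have ag: "?a \<oplus> g = \<zero>" and hc: "h \<oplus> ?c = \<zero>"
      using gh by simp_all
    have "\<epsilon> (x ?a * x b * x ?c) = sweedler (*) (\<Delta> (x b)) (\<lambda>g1 g2. \<epsilon> (x ?a * g1) * \<epsilon> (g2 * x ?c))"
      by (rule weak_multiplicative[rule_format, OF _ b _ xH xH xH]) simp_all
    also have "\<dots> = (\<Sum>u\<in>G. if ?a \<oplus> u = \<zero> then \<Sum>v\<in>G. if ?c \<oplus> v = \<zero> then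
        co_tensor (\<Delta> (x b)) u v * (\<epsilon> 1 * F ?a u * (\<epsilon> 1 * F v ?c)) else 0 else 0)"
      unfolding sweedler_bilin[OF bilin_eps]
      by (intro sum.cong refl) (auto simp: eps_mult add_Znm_commute[of n m ?c] intro!: sum.cong sum.neutral)
    also have "\<dots> = co_tensor (\<Delta> (x b)) g h * (\<epsilon> 1 * F ?a g * (\<epsilon> 1 * F h ?c))"
      using gh by (simp add: sum_add_eq)
    finally have eq: "co_tensor (\<Delta> (x b)) g h * (\<epsilon> 1 * F ?a g * (\<epsilon> 1 * F h ?c)) =
        \<epsilon> (x ?a * x b * x ?c)" by simp
    have ahb: "?a \<oplus> (g \<oplus> h) = h"
      using gh ag by (metis add_Znm_assoc add_zero_Znm)
    show ?thesis
    proof (cases "g \<oplus> h = b")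
      case True
      have "\<epsilon> (x ?a * x b * x ?c) = F ?a b * (\<epsilon> 1 * F h ?c)"
        using gh b hc ahb True by (simp add: x_mult[of ?a b] linear_scaleD[OF eps] eps_mult)
      moreover have "F g h * F ?a b = F ?a g"
        using F_inverse_cancel[of ?a g h] gh ag True by simp
      ultimately have "co_tensor (\<Delta> (x b)) g h * (\<epsilon> 1 * (F g h * F ?a b) * (\<epsilon> 1 * F h ?c)) =
          F ?a b * (\<epsilon> 1 * F h ?c)"
        using eq by (simp only:)
      then have "(co_tensor (\<Delta> (x b)) g h * (\<epsilon> 1 * F g h) - 1) * (\<epsilon> 1 * F ?a b * F h ?c) = 0"
        by (simp only: algebra_simps) simp
      then have "co_tensor (\<Delta> (x b)) g h * (\<epsilon> 1 * F g h) = 1"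
        using nonzero gh b by simp
      then show ?thesis
        using True nonzero gh by (simp add: field_simps)
    next
      case False
      \<comment> \<open>Translation by \<open>?a\<close> is injective; so the triple product has
        nonzero degree and is killed by \<open>\<epsilon>\<close>.\<close>
      have "?a \<oplus> b \<noteq> h"
        using False ahb gh b by (metis add_eq_iff add_in_Znm n_pos)
      then have "?a \<oplus> b \<oplus> ?c \<noteq> \<zero>"
        using gh b add_neg_eq_zero_iff[of "?a \<oplus> b" h] by auto
      then have "\<epsilon> (x ?a * x b * x ?c) = 0"
        using gh b by (simp add: x_mult[of ?a b] linear_scaleD[OF eps] eps_mult)
      with eq False nonzero gh show ?thesis by simp
    qed
  qed
  show ?thesis
  proof unfold_locales
    fix g h a assume gh: "g \<in> G" "h \<in> G"
    then have "Vector_Spaces.linear scale (*) (\<lambda>a. co_tensor (\<Delta> a) g h)"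
      using lin by (simp add: tensor_linear_def)
    from linear_expand[OF this, of a]
    show "co_tensor (\<Delta> a) g h = coef (g \<oplus> h) a / (\<epsilon> 1 * F g h)"
      using gh by (simp add: co_x mult_if_zero)
  next
    show "\<Delta> a \<in> tensor2_space scale" for a
      using lin by (simp add: tensor_linear_def)
  qed (rule nonzero eps_eq)+
qed

text \<open>Comparing the coefficients of \<open>1 \<otimes> 1\<close> in \<open>\<Delta> (1 * 1) = \<Delta> 1 * \<Delta> 1\<close> gives \<open>\<epsilon> 1 = n ^ m\<close>.\<close>

lemma weak_hopf_unique:
  assumes W: "weak_hopf_algebra n m R scale H \<Delta> \<epsilon> S"
  shows "twisted_coalgebra scale n m x F \<Delta> \<epsilon> (of_nat (n ^ m))" and "S = (\<lambda>a. a)"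
proof -
  interpret W: twisted_coalgebra scale n m x F \<Delta> \<epsilon> "\<epsilon> 1"
    by (rule weak_hopf_twisted_coalgebra[OF W])
  have "\<Delta> (1 * 1) = braided_mult n m R scale H (\<Delta> 1) (\<Delta> 1)"
    using W unfolding weak_hopf_algebra_def by blast
  then have "co_tensor (\<Delta> 1) \<zero> \<zero> = of_nat (n ^ m) / \<epsilon> 1 * co_tensor (\<Delta> 1) \<zero> \<zero>"
    using W.co_tensor_braided_mult_Delta[of \<zero> \<zero> 1 1] by simp
  moreover have "co_tensor (\<Delta> 1) \<zero> \<zero> \<noteq> 0"
    by (simp add: W.co_Delta coef_one)
  ultimately have "\<epsilon> 1 = of_nat (n ^ m)"
    by (simp add: field_simps)
  then show "twisted_coalgebra scale n m x F \<Delta> \<epsilon> (of_nat (n ^ m))"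
    using W.twisted_coalgebra_axioms by simp
  have S: "Vector_Spaces.linear scale scale S"
    using W unfolding weak_hopf_algebra_def by blast
  have xH: "x g \<in> H g" for g
    unfolding H_iff by (rule exI[of _ 1]) simp
  \<comment> \<open>Components are one-dimensional, so a degree-preserving \<open>S\<close> is
    diagonal in the monomial basis.\<close>
  have "\<forall>g\<in>G. \<exists>c. S (x g) = scale c (x g)"
    using W xH unfolding weak_hopf_algebra_def H_iff[symmetric] by blast
  then obtain s where s: "\<And>g. g \<in> G \<Longrightarrow> S (x g) = scale (s g) (x g)"
    by metis
  \<comment> \<open>Degree zero suffices: the antipode condition at \<open>1\<close> already fixes
    the sum of the eigenvalues.\<close>
  have "sweedler scale (\<Delta> (x \<zero>)) (\<lambda>h1 h2. h1 * S h2) =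
      sweedler scale (\<Delta> 1) (\<lambda>a b. \<Sum>u\<in>G. scale (R u \<zero> * \<epsilon> (a * x \<zero>)) (component n m H u b))"
    using W xH zero_in_Znm[OF n_pos] unfolding weak_hopf_algebra_def by blast
  then have "scale (sum s G / \<epsilon> 1) (x \<zero>) = x \<zero>"
    using W.antipode_convolution(1)[OF S s, of \<zero> 1] W.target_counital[of \<zero> 1] by simp
  then have "coef \<zero> (scale (sum s G / \<epsilon> 1) (x \<zero>)) = coef \<zero> (x \<zero>)"
    by simp
  then have sum: "sum s G = \<epsilon> 1"
    by (simp add: coef_scale coef_x)
  have "S (x g) = x g" if "g \<in> G" for g
  proof -
    have "S (x g) = sweedler scale (\<Delta> (x g)) (\<lambda>a h3. sweedler scale (\<Delta> a) (\<lambda>h1 h2. (S h1 * h2) * S h3))"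
      using W xH that unfolding weak_hopf_algebra_def by blast
    then show ?thesis
      using W.antipode_sum[OF S s sum that, of 1] by simp
  qed
  then have "S a = a" for a
    using linear_expand[OF S, of a] sum_coef[of a] by simp
  then show "S = (\<lambda>a. a)" by blast
qed

theorem ex1_weak_hopf_algebra:
  assumes "of_nat (n ^ m) \<noteq> (0 :: 'k)"
  shows "\<exists>!D. case D of (\<Delta>, \<epsilon>, S) \<Rightarrow> weak_hopf_algebra n m R scale H \<Delta> \<epsilon> S"
proof (rule ex1I[of _ "(Delta, \<lambda>a. of_nat (n ^ m) * coef \<zero> a, \<lambda>a. a)"])
  note D = twisted_coalgebra_Delta[OF assms]
  show "case (Delta, \<lambda>a. of_nat (n ^ m) * coef \<zero> a, \<lambda>a. a) of (\<Delta>, \<epsilon>, S) \<Rightarrow>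
      weak_hopf_algebra n m R scale H \<Delta> \<epsilon> S"
    using twisted_coalgebra.weak_hopf_algebra[OF D refl] by simp
  fix D assume "case D of (\<Delta>, \<epsilon>, S) \<Rightarrow> weak_hopf_algebra n m R scale H \<Delta> \<epsilon> S"
  then obtain \<Delta> \<epsilon> S where DD: "D = (\<Delta>, \<epsilon>, S)" and W: "weak_hopf_algebra n m R scale H \<Delta> \<epsilon> S"
    by (cases D) auto
  note U = weak_hopf_unique[OF W]
  have "\<Delta> a = Delta a" for a
    using twisted_coalgebra.co_Delta[OF U(1)] twisted_coalgebra.co_Delta[OF D]
    by (intro tensor2_space_eqI twisted_coalgebra.Delta_space[OF U(1)]
        twisted_coalgebra.Delta_space[OF D]) simp
  moreover have "\<epsilon> a = of_nat (n ^ m) * coef \<zero> a" for a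
    by (rule twisted_coalgebra.eps_eq[OF U(1)])
  ultimately show "D = (Delta, \<lambda>a. of_nat (n ^ m) * coef \<zero> a, \<lambda>a. a)"
    using U(2) unfolding DD by blast
qed

text \<open>The coefficients are characterised as inverses, so that any closed form can be inserted;
  \<open>F_GCA_diff\<close> supplies the one with powers of \<open>\<omega>\<close> and inverses of
  the \<open>q i\<close>.\<close>

lemma weak_hopf_Delta_x:
  assumes "weak_hopf_algebra n m R scale H \<Delta> \<epsilon> S" "g \<in> G"
    and c: "\<And>h. h \<in> G \<Longrightarrow> c h * (of_nat (n ^ m) * F h (g \<ominus> h)) = 1"
  shows "\<Delta> (x g) = tensor2 scale (\<Sum>h\<in>G. Poly_Mapping.single (x h, x (g \<ominus> h)) (c h))"
proof -
  interpret W: twisted_coalgebra scale n m x F \<Delta> \<epsilon> "of_nat (n ^ m)"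
    by (rule weak_hopf_unique[OF assms(1)])
  have "c h = 1 / (of_nat (n ^ m) * F h (g \<ominus> h))" if "h \<in> G" for h
    using c[OF that] by (metis mult_zero_right nonzero_eq_divide_eq zero_neq_one)
  with assms(2) show ?thesis
    by (intro tensor2_space_eqI W.Delta_space tensor2_in_space)
       (auto simp: co_tensor_tensor2 co2_homogeneous W.co_Delta coef_x)
qed

end

section \<open>Generalized Clifford algebras as twisted group algebras\<close>

text \<open>For letters at least \<open>1\<close>, this counts the pairs of positions whose left
  letter is the larger one: the exponent of \<open>\<omega>\<close> that sorting the word
  produces.\<close>

fun inversions :: "nat list \<Rightarrow> nat" where
  "inversions [] = 0"
| "inversions (i # w) = (\<Sum>j\<in>{1..<i}. count_list w j) + inversions w"

lemma count_list_replicate: "count_list (replicate a i) j = (if i = j then a else 0)"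
  by (induction a) auto

text \<open>Only the comparison between the two exchanged letters changes; every other letter sees
  the same letters to its right. This mirrors the relation between \<open>e i * e j\<close> and
  \<open>e j * e i\<close>.\<close>

lemma inversions_swap:
  "1 \<le> j \<Longrightarrow> j < i \<Longrightarrow> inversions (u @ [i, j] @ v) = Suc (inversions (u @ [j, i] @ v))"
proof (induction u)
  case Nil
  have "(\<Sum>k\<in>{1..<i}. count_list (j # v) k) = (\<Sum>k\<in>{1..<i}. (if k = j then 1 else 0) + count_list v k)"
    by (intro sum.cong) auto
  also have "\<dots> = 1 + (\<Sum>k\<in>{1..<i}. count_list v k)"
    using Nil by (simp add: sum.distrib)
  moreover have "(\<Sum>k\<in>{1..<j}. count_list (i # v) k) = (\<Sum>k\<in>{1..<j}. count_list v k)"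
    using Nil by (intro sum.cong) auto
  ultimately show ?case by simp
next
  case (Cons k u)
  have "(\<Sum>l\<in>{1..<k}. count_list (u @ [i, j] @ v) l) = (\<Sum>l\<in>{1..<k}. count_list (u @ [j, i] @ v) l)"
    by (intro sum.cong) auto
  then show ?case using Cons by simp
qed

lemma inversions_replicate:
  "inversions (replicate a i @ v) = a * (\<Sum>j\<in>{1..<i}. count_list v j) + inversions v"
proof (induction a)
  case (Suc a)
  have "(\<Sum>j\<in>{1..<i}. count_list (replicate a i @ v) j) = (\<Sum>j\<in>{1..<i}. count_list v j)"
    by (intro sum.cong) (auto simp: count_list_replicate)
  with Suc show ?case by simp
qed simp

text \<open>A block of \<open>n\<close> equal letters has no inversions inside and creates a
  multiple of \<open>n\<close> with the rest of the word.\<close>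

lemma power_inversions_block:
  fixes \<omega> :: "'k::field"
  assumes "\<omega> ^ n = 1"
  shows "\<omega> ^ inversions (u @ replicate n i @ v) = \<omega> ^ inversions (u @ v)"
proof (induction u)
  case Nil
  show ?case by (simp add: inversions_replicate power_add power_mult assms)
next
  case (Cons k u)
  have "(\<Sum>l\<in>{1..<k}. count_list (u @ replicate n i @ v) l) =
      (\<Sum>l\<in>{1..<k}. count_list (u @ v) l + (if l = i then n else 0))"
    by (intro sum.cong) (auto simp: count_list_replicate)
  also have "\<dots> = (\<Sum>l\<in>{1..<k}. count_list (u @ v) l) + (if i \<in> {1..<k} then n else 0)"
    by (simp add: sum.distrib)
  finally show ?case
    using Cons by (simp add: power_add assms)
qed

definition normal_word :: "nat \<Rightarrow> (nat \<Rightarrow> nat) \<Rightarrow> nat list" where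
  "normal_word m g = concat (map (\<lambda>i. replicate (g i) i) [1..<Suc m])"

lemma set_normal_word: "set (normal_word m g) \<subseteq> {1..m}"
  by (auto simp: normal_word_def)

lemma count_normal_word: "count_list (normal_word m g) i = (if i \<in> {1..m} then g i else 0)"
  by (induction m) (auto simp: normal_word_def count_list_replicate)

lemma monomial_Suc: "monomial (Suc k) e g = monomial k e g * e (Suc k) ^ g (Suc k)"
  by (simp add: monomial_def)

lemma monomial_0 [simp]: "monomial 0 e g = 1"
  by (simp add: monomial_def)

lemma monomial_zero: "monomial k e (\<lambda>_. 0) = 1"
  by (induction k) (simp_all add: monomial_Suc)

lemma monomial_cong: "(\<And>i. i \<in> {1..k} \<Longrightarrow> g i = h i) \<Longrightarrow> monomial k e g = monomial k e h"
  by (induction k) (auto simp: monomial_Suc)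

lemma eval_normal_word: "eval_word e (Word (normal_word m g)) = monomial m e g"
  by (induction m) (simp_all add: monomial_Suc normal_word_def eval_word_def prod_list_replicate)

text \<open>Generators are themselves monomials, so prefixing a letter to a word becomes an instance
  of the product rule \<open>x_mult\<close>.\<close>

lemma monomial_unit: "monomial k e (\<lambda>j. if j = i then 1 else 0) = (if i \<in> {1..k} then e i else 1)"
  by (induction k) (auto simp: monomial_Suc)

locale clifford =
  fixes n m :: nat and \<omega> :: "'k::field" and q :: "nat \<Rightarrow> 'k"
    and scale :: "'k \<Rightarrow> 'a::ring_1 \<Rightarrow> 'a" and e :: "nat \<Rightarrow> 'a"
  assumes n_pos: "n > 0"
    and root: "\<omega> ^ n = 1"
    and q_nonzero: "\<And>i. i \<in> {1..m} \<Longrightarrow> q i \<noteq> 0"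
    and gca: "generalized_clifford_algebra n m \<omega> q scale e"
begin

section \<open>Commutation rules and products of ordered monomials\<close>

lemma k_algebra: "k_algebra scale"
  using gca by (simp add: generalized_clifford_algebra_def presented_by_def)

sublocale vector_space scale
  using k_algebra by (simp add: k_algebra_def)

lemmas mult_scale [simp] = k_algebra_mult_scale[OF k_algebra]

lemma \<omega>_nonzero [simp]: "\<omega> \<noteq> 0"
  using root n_pos by (auto simp: zero_power)

text \<open>A relation lies in the ideal as \<open>1 * r * 1\<close>, and the presentation makes the
  ideal the kernel of evaluation.\<close>

lemma relation_zero:
  assumes "r \<in> gca_relations n m \<omega> q"
  shows "lin_ext scale (eval_word e) r = 0"
proof -
  have "(1 :: nat word \<Rightarrow>\<^sub>0 'k) \<in> free_algebra {1..m}"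
    by (simp add: free_algebra_def zero_word_def)
  then have "1 * r * 1 \<in> {u * r * v | u r v. u \<in> free_algebra {1..m} \<and>
      r \<in> gca_relations n m \<omega> q \<and> v \<in> free_algebra {1..m}}"
    using assms by blast
  then have "r \<in> relation_ideal {1..m} (gca_relations n m \<omega> q)"
    unfolding relation_ideal_def by (simp add: fscale.span_base)
  then show ?thesis
    using gca unfolding generalized_clifford_algebra_def presented_by_def by blast
qed

lemma e_power:
  assumes "i \<in> {1..m}"
  shows "e i ^ n = scale (q i) 1"
proof -
  have "Poly_Mapping.single (Word (replicate n i)) 1 - Poly_Mapping.single (Word []) (q i)
      \<in> gca_relations n m \<omega> q"
    unfolding gca_relations_def using assms by blast
  from relation_zero[OF this] show ?thesis
    by (simp add: lin_ext_diff eval_word_def prod_list_replicate)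
qed

lemma e_commute:
  assumes "i \<in> {1..m}" "j \<in> {1..m}" "j < i"
  shows "e i * e j = scale \<omega> (e j * e i)"
proof -
  have "Poly_Mapping.single (Word [i, j]) 1 - Poly_Mapping.single (Word [j, i]) \<omega>
      \<in> gca_relations n m \<omega> q"
    unfolding gca_relations_def using assms by blast
  from relation_zero[OF this] show ?thesis
    by (simp add: lin_ext_diff eval_word_def)
qed

text \<open>Each of the \<open>a * b\<close> crossings of \<open>e i\<close> with \<open>e j\<close>
  costs one factor \<open>\<omega>\<close>; the induction on \<open>b\<close> moves a single
  \<open>e i\<close>, the induction on \<open>a\<close> all of them.\<close>

lemma e_power_commute:
  assumes "i \<in> {1..m}" "j \<in> {1..m}" "j < i"
  shows "e i ^ a * e j ^ b = scale (\<omega> ^ (a * b)) (e j ^ b * e i ^ a)"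
proof -
  have 1: "e i * e j ^ b = scale (\<omega> ^ b) (e j ^ b * e i)"
  proof (induction b)
    case (Suc b)
    have "e i * e j ^ Suc b = scale \<omega> (e j * (e i * e j ^ b))"
      by (simp add: mult.assoc[symmetric] e_commute[OF assms])
    then show ?case by (simp add: Suc mult.assoc)
  qed simp
  show ?thesis
  proof (induction a)
    case (Suc a)
    have "e i ^ Suc a * e j ^ b = e i * (e i ^ a * e j ^ b)"
      by (simp add: mult.assoc)
    also have "\<dots> = scale (\<omega> ^ (a * b)) (e i * e j ^ b * e i ^ a)"
      by (simp add: Suc mult.assoc)
    also have "\<dots> = scale (\<omega> ^ (Suc a * b)) (e j ^ b * e i ^ Suc a)"
      by (simp add: 1 mult.assoc power_add mult.commute)
    finally show ?case .
  qed simp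
qed

lemma e_power_monomial:
  assumes "i \<in> {1..m}" "k < i"
  shows "e i ^ a * monomial k e b = scale (\<omega> ^ (a * (\<Sum>j\<in>{1..k}. b j))) (monomial k e b * e i ^ a)"
  using assms
proof (induction k)
  case (Suc k)
  have "e i ^ a * monomial (Suc k) e b = (e i ^ a * monomial k e b) * e (Suc k) ^ b (Suc k)"
    by (simp add: monomial_Suc mult.assoc)
  also have "\<dots> = scale (\<omega> ^ (a * (\<Sum>j\<in>{1..k}. b j)))
      (monomial k e b * (e i ^ a * e (Suc k) ^ b (Suc k)))"
    using Suc by (simp add: mult.assoc)
  also have "e i ^ a * e (Suc k) ^ b (Suc k) =
      scale (\<omega> ^ (a * b (Suc k))) (e (Suc k) ^ b (Suc k) * e i ^ a)"
    using Suc.prems by (intro e_power_commute) auto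
  finally show ?case
    by (simp add: monomial_Suc mult.assoc power_add[symmetric] algebra_simps)
qed simp

text \<open>Induction on the number of generators: the last block of the left factor is moved past
  the earlier blocks of the right factor, which yields the summand \<open>i = Suc k\<close> of the
  exponent.\<close>

lemma monomial_mult:
  "k \<le> m \<Longrightarrow> monomial k e a * monomial k e b =
    scale (\<omega> ^ (\<Sum>i\<in>{1..k}. \<Sum>j\<in>{1..<i}. a i * b j)) (monomial k e (\<lambda>i. a i + b i))"
proof (induction k)
  case (Suc k)
  let ?e = "e (Suc k)"
  have "monomial (Suc k) e a * monomial (Suc k) e b =
      monomial k e a * (?e ^ a (Suc k) * monomial k e b) * ?e ^ b (Suc k)"
    by (simp add: monomial_Suc mult.assoc)
  also have "\<dots> = scale (\<omega> ^ (a (Suc k) * (\<Sum>j\<in>{1..k}. b j)))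
      (monomial k e a * monomial k e b * (?e ^ (a (Suc k) + b (Suc k))))"
    using Suc.prems by (subst e_power_monomial) (auto simp: mult.assoc power_add)
  also have "\<dots> = scale (\<omega> ^ (\<Sum>i\<in>{1..Suc k}. \<Sum>j\<in>{1..<i}. a i * b j))
      (monomial (Suc k) e (\<lambda>i. a i + b i))"
    using Suc by (simp add: monomial_Suc power_add sum_distrib_left atLeastLessThanSuc_atLeastAtMost
        mult.commute)
  finally show ?case .
qed simp

lemma monomial_mod:
  "k \<le> m \<Longrightarrow> monomial k e a = scale (\<Prod>i\<in>{1..k}. q i ^ (a i div n)) (monomial k e (\<lambda>i. a i mod n))"
proof (induction k)
  case (Suc k)
  have "e (Suc k) ^ a (Suc k) = (e (Suc k) ^ n) ^ (a (Suc k) div n) * e (Suc k) ^ (a (Suc k) mod n)"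
    by (simp add: power_mult[symmetric] power_add[symmetric])
  moreover have "scale c 1 ^ b = scale (c ^ b) 1" for c b
    by (induction b) auto
  ultimately have "e (Suc k) ^ a (Suc k) =
      scale (q (Suc k) ^ (a (Suc k) div n)) (e (Suc k) ^ (a (Suc k) mod n))"
    using Suc.prems by (simp add: e_power)
  with Suc show ?case
    by (simp add: monomial_Suc mult.commute)
qed simp

abbreviation x where "x \<equiv> monomial m e"

lemma monomial_reduce:
  "\<exists>c. \<exists>g\<in>Znm n m. x a = scale c (x g)"
proof -
  have "x a = scale (\<Prod>i\<in>{1..m}. q i ^ (a i div n)) (x (\<lambda>i\<in>{1..m}. a i mod n))"
    by (subst monomial_mod[OF order_refl]) (auto intro!: arg_cong[of _ _ "scale _"] monomial_cong)
  moreover have "(\<lambda>i\<in>{1..m}. a i mod n) \<in> Znm n m"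
    using n_pos by (auto simp: Znm_def)
  ultimately show ?thesis by blast
qed

text \<open>The exponent functions are arbitrary, so the rule also applies to the unit vectors in
  \<open>eval_word_reduce\<close>, which are not restricted to \<open>{1..m}\<close>. The powers of
  the \<open>q i\<close> come from reducing exponents modulo \<open>n\<close>.\<close>

lemma x_mult: "x g * x h = scale (F_GCA n m \<omega> q g h) (x (add_Znm n m g h))"
proof -
  have "x g * x h = scale (\<omega> ^ (\<Sum>i\<in>{1..m}. \<Sum>j\<in>{1..<i}. g i * h j)) (x (\<lambda>i. g i + h i))"
    by (rule monomial_mult) simp
  also have "x (\<lambda>i. g i + h i) =
      scale (\<Prod>i\<in>{1..m}. q i ^ ((g i + h i) div n)) (x (\<lambda>i. (g i + h i) mod n))"
    by (rule monomial_mod) simp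
  also have "x (\<lambda>i. (g i + h i) mod n) = x (add_Znm n m g h)"
    by (rule monomial_cong) (simp add: add_Znm_def)
  finally show ?thesis
    by (simp add: F_GCA_def)
qed

section \<open>Reduced monomials span\<close>

lemma eval_word_reduce:
  "set w \<subseteq> {1..m} \<Longrightarrow> \<exists>c. \<exists>g\<in>Znm n m. eval_word e (Word w) = scale c (x g)"
proof (induction w)
  case Nil
  have "eval_word e (Word []) = x (\<lambda>_. 0)"
    by (simp add: eval_word_def monomial_zero)
  then show ?case using monomial_reduce by metis
next
  case (Cons i w)
  then obtain c g where "g \<in> Znm n m" "eval_word e (Word w) = scale c (x g)"
    by auto
  moreover have "e i = x (\<lambda>j. if j = i then 1 else 0)"
    using Cons.prems by (simp add: monomial_unit)
  ultimately have "eval_word e (Word (i # w)) = scale c (x (\<lambda>j. if j = i then 1 else 0) * x g)"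
    by (simp add: eval_word_def)
  then show ?case
    unfolding x_mult scale_scale by (intro exI bexI[OF _ add_in_Znm[OF n_pos]])
qed

text \<open>Evaluation is onto and sends each word to a multiple of a reduced monomial; words of
  equal degree are then collected.\<close>

lemma spanning: "\<exists>c. a = (\<Sum>g\<in>Znm n m. scale (c g) (x g))"
proof -
  have "a \<in> lin_ext scale (eval_word e) ` free_algebra {1..m}"
    using gca by (simp add: generalized_clifford_algebra_def presented_by_def)
  then obtain p where p: "p \<in> free_algebra {1..m}" "a = lin_ext scale (eval_word e) p"
    by blast
  have "\<forall>w\<in>Poly_Mapping.keys p. \<exists>c. \<exists>g\<in>Znm n m. eval_word e w = scale c (x g)"
    using p(1) eval_word_reduce[of "letters _"] by (auto simp: free_algebra_def)
  then obtain c d where cd: "\<And>w. w \<in> Poly_Mapping.keys p \<Longrightarrow>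
      d w \<in> Znm n m \<and> eval_word e w = scale (c w) (x (d w))"
    by metis
  have "a = (\<Sum>w\<in>Poly_Mapping.keys p. \<Sum>g\<in>Znm n m.
      if g = d w then scale (Poly_Mapping.lookup p w * c w) (x g) else 0)"
    unfolding p(2) lin_ext_def by (intro sum.cong refl) (simp add: cd finite_Znm)
  also have "\<dots> = (\<Sum>g\<in>Znm n m. \<Sum>w\<in>Poly_Mapping.keys p.
      if g = d w then scale (Poly_Mapping.lookup p w * c w) (x g) else 0)"
    by (rule sum.swap)
  also have "\<dots> = (\<Sum>g\<in>Znm n m. scale (\<Sum>w\<in>Poly_Mapping.keys p.
      if g = d w then Poly_Mapping.lookup p w * c w else 0) (x g))"
    by (intro sum.cong refl) (auto simp: scale_sum_left intro!: sum.cong)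
  finally show ?thesis
    by (rule exI[of _ "\<lambda>g. \<Sum>w\<in>Poly_Mapping.keys p. if g = d w then Poly_Mapping.lookup p w * c w else 0"])
qed

section \<open>Linear independence of the reduced monomials\<close>

definition word_degree :: "nat list \<Rightarrow> nat \<Rightarrow> nat" where
  "word_degree w = (\<lambda>i\<in>{1..m}. count_list w i mod n)"

definition word_weight :: "nat list \<Rightarrow> 'k" where
  "word_weight w = \<omega> ^ inversions w * (\<Prod>i\<in>{1..m}. q i ^ (count_list w i div n))"

text \<open>A word evaluates to \<open>word_weight\<close> times the monomial of degree \<open>word_degree\<close> as soon as the
  relations hold; this functional reads off that coefficient on the free algebra.\<close>

definition word_coef :: "(nat \<Rightarrow> nat) \<Rightarrow> nat word \<Rightarrow> 'k" where
  "word_coef g w = (if word_degree (letters w) = g then word_weight (letters w) else 0)"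

abbreviation normal_coef :: "(nat \<Rightarrow> nat) \<Rightarrow> (nat word \<Rightarrow>\<^sub>0 'k) \<Rightarrow> 'k" where
  "normal_coef g \<equiv> lin_ext (*) (word_coef g)"

lemma linear_normal_coef: "Vector_Spaces.linear fscale (*) (normal_coef g)"
  by (rule vector_space.linear_lin_ext[OF vector_space_mult])

text \<open>Inserting \<open>n\<close> copies of \<open>i\<close> keeps all counts modulo
  \<open>n\<close>, changes the inversions by a multiple of \<open>n\<close>, and raises the
  quotient of the count of \<open>i\<close> by one.\<close>

lemma word_coef_power:
  assumes "i \<in> {1..m}"
  shows "word_coef g (Word (u @ replicate n i @ v)) = q i * word_coef g (Word (u @ v))"
proof -
  have count: "count_list (u @ replicate n i @ v) j = count_list (u @ v) j + (if j = i then n else 0)" for j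
    by (auto simp: count_list_replicate)
  have "word_degree (u @ replicate n i @ v) = word_degree (u @ v)"
    unfolding word_degree_def count by (auto simp: fun_eq_iff)
  moreover have "(\<Prod>j\<in>{1..m}. q j ^ (count_list (u @ replicate n i @ v) j div n)) =
      (\<Prod>j\<in>{1..m}. (if j = i then q i else 1) * q j ^ (count_list (u @ v) j div n))"
    unfolding count using n_pos by (intro prod.cong) auto
  then have "(\<Prod>j\<in>{1..m}. q j ^ (count_list (u @ replicate n i @ v) j div n)) =
      q i * (\<Prod>j\<in>{1..m}. q j ^ (count_list (u @ v) j div n))"
    using assms by (simp add: prod.distrib)
  ultimately show ?thesis
    using power_inversions_block[OF root, of u i v] by (simp add: word_coef_def word_weight_def)
qed

lemma word_coef_swap:
  assumes "j \<in> {1..m}" "j < i"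
  shows "word_coef g (Word (u @ [i, j] @ v)) = \<omega> * word_coef g (Word (u @ [j, i] @ v))"
proof -
  have count: "count_list (u @ [i, j] @ v) = count_list (u @ [j, i] @ v)"
    by (auto simp: fun_eq_iff)
  have "word_degree (u @ [i, j] @ v) = word_degree (u @ [j, i] @ v)"
    unfolding word_degree_def count ..
  moreover have "word_weight (u @ [i, j] @ v) = \<omega> * word_weight (u @ [j, i] @ v)"
  proof -
    have "\<omega> ^ inversions (u @ [i, j] @ v) = \<omega> * \<omega> ^ inversions (u @ [j, i] @ v)"
      using assms by (subst inversions_swap) auto
    then show ?thesis
      unfolding word_weight_def count by (simp only: mult.assoc)
  qed
  ultimately show ?thesis
    by (simp add: word_coef_def)
qed

text \<open>By bilinearity \<open>u\<close> and \<open>v\<close> may be taken to be single words;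
  \<open>word_coef_power\<close> and \<open>word_coef_swap\<close> then say that the two terms of a
  relation have equal coefficients.\<close>

lemma normal_coef_relation:
  assumes "r \<in> gca_relations n m \<omega> q"
  shows "normal_coef g (u * r * v) = 0"
proof -
  note lin = vector_space.lin_ext_single[OF vector_space_mult]
    vector_space.lin_ext_diff[OF vector_space_mult] vector_space.lin_ext_sum[OF vector_space_mult]
  have single: "normal_coef g (Poly_Mapping.single w a * r * Poly_Mapping.single w' b) = 0" for w w' a b
    using assms unfolding gca_relations_def
    by (auto simp: left_diff_distrib right_diff_distrib mult_single lin plus_word_def
        word_coef_power[unfolded append_assoc] word_coef_swap[unfolded append_assoc, simplified])
  have "u * r * v = (\<Sum>w\<in>Poly_Mapping.keys u. Poly_Mapping.single w (Poly_Mapping.lookup u w)) * r *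
      (\<Sum>w\<in>Poly_Mapping.keys v. Poly_Mapping.single w (Poly_Mapping.lookup v w))"
    using poly_mapping_eq_sum_single[of u] poly_mapping_eq_sum_single[of v] by simp
  then show ?thesis
    by (simp add: sum_distrib_left sum_distrib_right lin single)
qed

lemma normal_coef_relation_ideal:
  assumes "p \<in> relation_ideal {1..m} (gca_relations n m \<omega> q)"
  shows "normal_coef g p = 0"
  using assms unfolding relation_ideal_def
proof (induction rule: fscale.span_induct)
  case base
  show ?case
    by (auto simp: fscale.subspace_def linear_0D[OF linear_normal_coef]
        linear_addD[OF linear_normal_coef] linear_scaleD[OF linear_normal_coef])
qed (auto simp: normal_coef_relation)

text \<open>A vanishing combination of monomials lifts to normal words and lands in the relation
  ideal, where \<open>normal_coef h\<close> vanishes. On the lift this functional returns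
  \<open>c h\<close> times a nonzero weight.\<close>

lemma independence:
  assumes "(\<Sum>g\<in>Znm n m. scale (c g) (x g)) = 0" "h \<in> Znm n m"
  shows "c h = 0"
proof -
  let ?p = "\<Sum>g\<in>Znm n m. Poly_Mapping.single (Word (normal_word m g)) (c g)"
  have "Poly_Mapping.keys ?p \<subseteq> (\<Union>g\<in>Znm n m. {Word (normal_word m g)})"
    by (rule order_trans[OF Poly_Mapping.keys_sum]) auto
  then have "?p \<in> free_algebra {1..m}"
    using set_normal_word by (fastforce simp: free_algebra_def)
  moreover have "lin_ext scale (eval_word e) ?p = 0"
    by (simp add: lin_ext_sum eval_normal_word assms(1))
  ultimately have "?p \<in> relation_ideal {1..m} (gca_relations n m \<omega> q)"
    using gca unfolding generalized_clifford_algebra_def presented_by_def by blast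
  then have "normal_coef h ?p = 0"
    by (rule normal_coef_relation_ideal)
  \<comment> \<open>Exponents are recovered from letter counts, so \<open>normal_coef h\<close> sees
    only the normal word of degree \<open>h\<close>.\<close>
  moreover have degree: "word_degree (normal_word m g) = g" if "g \<in> Znm n m" for g
    by (rule Znm_eqI[of _ n m])
       (use that n_pos in \<open>auto simp: word_degree_def count_normal_word Znm_less, auto simp: Znm_def\<close>)
  then have "normal_coef h ?p = (\<Sum>g\<in>Znm n m. if g = h then c h * word_weight (normal_word m h) else 0)"
    unfolding linear_sumD[OF linear_normal_coef]
    by (intro sum.cong refl)
       (auto simp: vector_space.lin_ext_single[OF vector_space_mult] word_coef_def)
  ultimately have "c h * word_weight (normal_word m h) = 0"
    using assms(2) by (simp add: finite_Znm)
  then show ?thesis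
    using q_nonzero by (simp add: word_weight_def)
qed

section \<open>Identification with a twisted group algebra and the explicit coefficients\<close>

sublocale twisted_group_algebra scale n m x "F_GCA n m \<omega> q"
proof
  show "x (zero_Znm m) = 1"
    using monomial_cong[of m "zero_Znm m" "\<lambda>_. 0" e] by (simp add: zero_Znm_def monomial_zero)
  show "F_GCA n m \<omega> q g h \<noteq> 0" for g h
    using q_nonzero by (simp add: F_GCA_def)
qed (use finite_Znm spanning independence n_pos k_algebra x_mult in blast)+

lemma H_eq_gca_grading: "H = gca_grading m scale e"
  by (simp add: fun_eq_iff H_def gca_grading_def)

text \<open>The explicit coefficient inverts \<open>n ^ m\<close> times the cocycle at
  \<open>h\<close> and \<open>g - h\<close>: the powers of \<open>\<omega>\<close> cancel, and
  \<open>q i\<close> occurs in the cocycle exactly where adding \<open>h i\<close> to the residue of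
  \<open>g i - h i\<close> carries.\<close>

lemma F_GCA_diff:
  assumes "g \<in> Znm n m" "h \<in> Znm n m" "of_nat (n ^ m) \<noteq> (0 :: 'k)"
  shows "1 / of_nat (n ^ m) *
      \<omega> powi (- (\<Sum>i\<in>{1..m}. \<Sum>j\<in>{1..<i}. int (h i) * int (diff_Znm n m g h j))) *
      (\<Prod>i\<in>{1..m}. if h i > g i then inverse (q i) else 1) *
    (of_nat (n ^ m) * F_GCA n m \<omega> q h (diff_Znm n m g h)) = 1"
proof -
  let ?d = "diff_Znm n m g h"
  let ?K = "\<Sum>i\<in>{1..m}. \<Sum>j\<in>{1..<i}. h i * ?d j"
  have "(\<Sum>i\<in>{1..m}. \<Sum>j\<in>{1..<i}. int (h i) * int (?d j)) = int ?K"
    by simp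
  then have power: "\<omega> powi (- (\<Sum>i\<in>{1..m}. \<Sum>j\<in>{1..<i}. int (h i) * int (?d j))) = inverse (\<omega> ^ ?K)"
    by (simp only: power_int_minus power_int_of_nat)
  have carry: "(h i + ?d i) div n = (if h i > g i then 1 else 0)" if i: "i \<in> {1..m}" for i
  proof (cases "h i > g i")
    case True
    \<comment> \<open>The difference is negative but greater than \<open>- n\<close>, so one shift
      by \<open>n\<close> gives its residue.\<close>
    have "(int (g i) - int (h i)) mod int n = int (g i) - int (h i) + int n"
      using Znm_less[OF assms(1) i] Znm_less[OF assms(2) i] True
      by (intro mod_pos_pos_trivial[THEN trans[OF mod_add_self2[symmetric]]]) auto
    then have "h i + ?d i = g i + n"
      using i True Znm_less[OF assms(2) i] by (simp add: diff_Znm_def)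
    then show ?thesis
      using True Znm_less[OF assms(1) i] by simp
  next
    case False
    have "(int (g i) - int (h i)) mod int n = int (g i) - int (h i)"
      using Znm_less[OF assms(1) i] False by (intro mod_pos_pos_trivial) auto
    then have "h i + ?d i = g i"
      using i False by (simp add: diff_Znm_def)
    then show ?thesis
      using False Znm_less[OF assms(1) i] by simp
  qed
  have "(\<Prod>i\<in>{1..m}. if h i > g i then inverse (q i) else 1) * (\<Prod>i\<in>{1..m}. q i ^ ((h i + ?d i) div n)) =
      (\<Prod>i\<in>{1..m}. 1)"
    unfolding prod.distrib[symmetric] using q_nonzero by (intro prod.cong refl) (simp add: carry)
  then have prod: "(\<Prod>i\<in>{1..m}. if h i > g i then inverse (q i) else 1) *
      (\<Prod>i\<in>{1..m}. q i ^ ((h i + ?d i) div n)) = 1"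
    by simp
  have cancel: "1 / N * inverse W * A * (N * (W * B)) = A * B" if "N \<noteq> 0" "W \<noteq> 0" for N W A B :: 'k
    using that by (simp add: field_simps)
  have "\<omega> ^ ?K \<noteq> 0" by simp
  then show ?thesis
    unfolding power F_GCA_def by (subst cancel[OF assms(3)]) (simp_all only: prod, simp)
qed

end

theorem theorem4p4:
  fixes n m :: nat
    and \<omega> :: "'k::field"
    and q :: "nat \<Rightarrow> 'k"
    and scale :: "'k \<Rightarrow> 'a::ring_1 \<Rightarrow> 'a"
    and e :: "nat \<Rightarrow> 'a"
  assumes "n \<ge> 2"
    and "\<not> CHAR('k) dvd n"
    and "primitive_root_of_unity n \<omega>"
    and "m \<ge> 1"
    and "\<And>i. i \<in> {1..m} \<Longrightarrow> q i \<noteq> 0"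
    and "generalized_clifford_algebra n m \<omega> q scale e"
  shows "(\<exists>!D. case D of (\<Delta>, \<epsilon>, S) \<Rightarrow>
            weak_hopf_algebra n m (braiding_of (F_GCA n m \<omega> q)) scale (gca_grading m scale e) \<Delta> \<epsilon> S) \<and>
    (\<forall>\<Delta> \<epsilon> S.
       weak_hopf_algebra n m (braiding_of (F_GCA n m \<omega> q)) scale (gca_grading m scale e) \<Delta> \<epsilon> S \<longrightarrow>
       (\<forall>g\<in>Znm n m.
          \<Delta> (monomial m e g) = tensor2 scale
            (\<Sum>h\<in>Znm n m. Poly_Mapping.single (monomial m e h, monomial m e (diff_Znm n m g h))
               (1 / of_nat (n ^ m) *
                \<omega> powi (- (\<Sum>i\<in>{1..m}. \<Sum>j\<in>{1..<i}. int (h i) * int (diff_Znm n m g h j))) *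
                (\<Prod>i\<in>{1..m}. if h i > g i then inverse (q i) else 1))) \<and>
          \<epsilon> (monomial m e g) = of_nat (n ^ m) * (if g = zero_Znm m then 1 else 0) \<and>
          S (monomial m e g) = monomial m e g))"
proof -
  interpret clifford n m \<omega> q scale e
    using assms by unfold_locales (auto simp: primitive_root_of_unity_def)
  \<comment> \<open>In a field \<open>n ^ m\<close> can vanish only if \<open>n\<close> does, that
    is, only if the characteristic divides \<open>n\<close>.\<close>
  have N: "of_nat (n ^ m) \<noteq> (0 :: 'k)"
    using assms(2) by (simp add: of_nat_eq_0_iff_char_dvd)
  have "\<Delta> (x g) = tensor2 scale
            (\<Sum>h\<in>Znm n m. Poly_Mapping.single (x h, x (diff_Znm n m g h))
               (1 / of_nat (n ^ m) *
                \<omega> powi (- (\<Sum>i\<in>{1..m}. \<Sum>j\<in>{1..<i}. int (h i) * int (diff_Znm n m g h j))) *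
                (\<Prod>i\<in>{1..m}. if h i > g i then inverse (q i) else 1))) \<and>
          \<epsilon> (x g) = of_nat (n ^ m) * (if g = zero_Znm m then 1 else 0) \<and> S (x g) = x g"
    if W: "weak_hopf_algebra n m R scale H \<Delta> \<epsilon> S" and g: "g \<in> Znm n m" for \<Delta> \<epsilon> S g
    using weak_hopf_Delta_x[OF W g F_GCA_diff[OF g _ N]] weak_hopf_unique(2)[OF W]
      twisted_coalgebra.eps_x[OF weak_hopf_unique(1)[OF W] g]
    by simp
  with ex1_weak_hopf_algebra[OF N] show ?thesis
    unfolding H_eq_gca_grading by blast
qed

end
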